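(* Let $d\ge 3$. The singular locus of the $d$th gamma moment variety $\mathcal{M}^{\Gamma}_d\subseteq\mathbb{P}^d$ consists of the two points of $\mathbb{P}^d$ defined by the ideals $(m_0,m_1,\ldots,m_{d-1})$ and $(m_1,m_2,\ldots,m_d)$.
   Context: The moments of the gamma distribution with shape parameter $k$ and scale parameter $\theta$ are $m_0=1$ and $m_i=\theta^i\prod_{j=0}^{i-1}(k+j)$ for $i\ge 1$. The gamma moment variety $\mathcal{M}^{\Gamma}_d\subseteq\mathbb{P}^d$ is the Zariski closure of the image of the map $\mathbb{C}^2\to\mathbb{P}^d$, $(k,\theta)\mapsto[m_0(k,\theta):m_1(k,\theta):\cdots:m_d(k,\theta)]$ (complex projective space with homogeneous coordinates $m_0,\dots,m_d$). *)

theory Defs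
  imports Complex_Main "HOL-Library.Poly_Mapping" "HOL-Library.Function_Algebras"
    "HOL-Library.Extended_Nat"
begin

section \<open>Polynomials in \<open>m\<^sub>0, \<dots>, m\<^sub>d\<close>\<close>

text \<open>
  A monomial is its finitely supported exponent vector, a polynomial a finitely supported
  coefficient function on monomials; multiplication is the convolution product of
  \<open>HOL-Library.Poly_Mapping\<close>. The coordinate ring of \<open>\<complex>\<^sup>d\<^sup>+\<^sup>1\<close> is the subring using only the
  variables \<open>0, \<dots>, d\<close>.
\<close>

type_synonym mpoly = "(nat \<Rightarrow>\<^sub>0 nat) \<Rightarrow>\<^sub>0 complex"

definition poly_ring :: "nat \<Rightarrow> mpoly set" where
  "poly_ring d = {f. \<forall>t\<in>Poly_Mapping.keys f. Poly_Mapping.keys t \<subseteq> {..d}}"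

definition pvar :: "nat \<Rightarrow> mpoly" where
  "pvar i = Poly_Mapping.single (Poly_Mapping.single i 1) 1"

definition homogeneous :: "mpoly \<Rightarrow> bool" where
  "homogeneous f \<longleftrightarrow> (\<exists>n. \<forall>t\<in>Poly_Mapping.keys f.
      (\<Sum>i\<in>Poly_Mapping.keys t. Poly_Mapping.lookup t i) = n)"

definition peval :: "mpoly \<Rightarrow> (nat \<Rightarrow> complex) \<Rightarrow> complex" where
  "peval f x = (\<Sum>t\<in>Poly_Mapping.keys f. Poly_Mapping.lookup f t *
      (\<Prod>i\<in>Poly_Mapping.keys t. x i ^ Poly_Mapping.lookup t i))"

text \<open>
  Formal partial derivative. Monomials not containing variable \<open>i\<close>, where the subtraction of
  exponents truncates, contribute \<open>0\<close> because of the factor \<open>lookup t i\<close>.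
\<close>

definition pdiff :: "nat \<Rightarrow> mpoly \<Rightarrow> mpoly" where
  "pdiff i f = (\<Sum>t\<in>Poly_Mapping.keys f.
      Poly_Mapping.single (t - Poly_Mapping.single i 1)
        (of_nat (Poly_Mapping.lookup t i) * Poly_Mapping.lookup f t))"

definition ideal_gen :: "nat \<Rightarrow> mpoly set \<Rightarrow> mpoly set" where
  "ideal_gen d B = {(\<Sum>b\<in>S. c b * b) |S c. finite S \<and> S \<subseteq> B \<and> (\<forall>b\<in>S. c b \<in> poly_ring d)}"


section \<open>Projective space and its Zariski topology\<close>

text \<open>
  Vectors of \<open>\<complex>\<^sup>d\<^sup>+\<^sup>1\<close> are functions vanishing beyond index \<open>d\<close>. A point of \<open>\<P>\<^sup>d\<close> is the set of all
  its homogeneous coordinate vectors.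
\<close>

type_synonym ppoint = "(nat \<Rightarrow> complex) set"

definition vecs :: "nat \<Rightarrow> (nat \<Rightarrow> complex) set" where
  "vecs d = {x. \<forall>i>d. x i = 0}"

definition hpoint :: "(nat \<Rightarrow> complex) \<Rightarrow> ppoint" where
  "hpoint x = {(\<lambda>i. c * x i) |c. c \<noteq> 0}"

definition proj_space :: "nat \<Rightarrow> ppoint set" where
  "proj_space d = {hpoint x |x. x \<in> vecs d \<and> (\<exists>i. x i \<noteq> 0)}"

definition proj_zeros :: "nat \<Rightarrow> mpoly set \<Rightarrow> ppoint set" where
  "proj_zeros d F = {P \<in> proj_space d. \<forall>f\<in>F. \<forall>x\<in>P. peval f x = 0}"

definition zariski_closed :: "nat \<Rightarrow> ppoint set \<Rightarrow> bool" where
  "zariski_closed d S \<longleftrightarrow> (\<exists>F. F \<subseteq> poly_ring d \<and> (\<forall>f\<in>F. homogeneous f) \<and> S = proj_zeros d F)"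

definition zariski_closure :: "nat \<Rightarrow> ppoint set \<Rightarrow> ppoint set" where
  "zariski_closure d S = zariski_closed d hull S"

definition irreducible_closed :: "nat \<Rightarrow> ppoint set \<Rightarrow> bool" where
  "irreducible_closed d Z \<longleftrightarrow> zariski_closed d Z \<and> Z \<noteq> {} \<and>
     (\<forall>A B. zariski_closed d A \<and> zariski_closed d B \<and> Z = A \<union> B \<longrightarrow> Z = A \<or> Z = B)"

definition vanishing_ideal :: "nat \<Rightarrow> ppoint set \<Rightarrow> mpoly set" where
  "vanishing_ideal d X =
     ideal_gen d {f \<in> poly_ring d. homogeneous f \<and> (\<forall>P\<in>X. \<forall>x\<in>P. peval f x = 0)}"


section \<open>Singular points\<close>

text \<open>
  The dimension of \<open>X\<close> at \<open>P\<close>: the supremum of the lengths \<open>n\<close> of chains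
  \<open>Z\<^sub>0 \<subset> \<dots> \<subset> Z\<^sub>n\<close> of irreducible closed subsets of \<open>X\<close> containing \<open>P\<close>, i.e. the Krull dimension
  of the local ring of \<open>X\<close> at \<open>P\<close>.
\<close>

definition local_dim :: "nat \<Rightarrow> ppoint set \<Rightarrow> ppoint \<Rightarrow> enat" where
  "local_dim d X P = Sup {enat n |n. \<exists>Z :: nat \<Rightarrow> ppoint set.
      (\<forall>i\<le>n. irreducible_closed d (Z i) \<and> P \<in> Z i \<and> Z i \<subseteq> X) \<and> (\<forall>i<n. Z i \<subset> Z (Suc i))}"

text \<open>
  The kernel of the Jacobian matrix of the homogeneous ideal of \<open>X\<close> at \<open>P\<close>, i.e. the tangent space
  of the affine cone over \<open>X\<close>. It does not depend on the coordinate vector \<open>x\<close> of \<open>P\<close>. It contains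
  the line through \<open>x\<close>, so that its dimension is one more than that of the
  Zariski tangent space of \<open>X\<close> at \<open>P\<close>.
\<close>

definition cone_tangent_space :: "nat \<Rightarrow> ppoint set \<Rightarrow> ppoint \<Rightarrow> (nat \<Rightarrow> complex) set" where
  "cone_tangent_space d X P =
     {v \<in> vecs d. \<forall>f\<in>vanishing_ideal d X. \<forall>x\<in>P. (\<Sum>i\<le>d. peval (pdiff i f) x * v i) = 0}"

definition vec_scale :: "complex \<Rightarrow> (nat \<Rightarrow> complex) \<Rightarrow> (nat \<Rightarrow> complex)" where
  "vec_scale c v = (\<lambda>i. c * v i)"

lemma vector_space_vec_scale: "vector_space vec_scale"
  by unfold_locales (auto simp: vec_scale_def fun_eq_iff algebra_simps)

definition tangent_dim :: "nat \<Rightarrow> ppoint set \<Rightarrow> ppoint \<Rightarrow> nat" where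
  "tangent_dim d X P = vector_space.dim vec_scale (cone_tangent_space d X P) - 1"

definition singular_locus :: "nat \<Rightarrow> ppoint set \<Rightarrow> ppoint set" where
  "singular_locus d X = {P \<in> X. enat (tangent_dim d X P) > local_dim d X P}"


section \<open>The gamma moment variety\<close>

definition gamma_moment :: "nat \<Rightarrow> complex \<Rightarrow> complex \<Rightarrow> complex" where
  "gamma_moment i k \<theta> = \<theta> ^ i * (\<Prod>j<i. k + of_nat j)"

definition gamma_moment_point :: "nat \<Rightarrow> complex \<Rightarrow> complex \<Rightarrow> ppoint" where
  "gamma_moment_point d k \<theta> = hpoint (\<lambda>i. if i \<le> d then gamma_moment i k \<theta> else 0)"

definition gamma_moment_variety :: "nat \<Rightarrow> ppoint set" where
  "gamma_moment_variety d = zariski_closure d {gamma_moment_point d k \<theta> |k \<theta>. True}"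

end

(*
  With u = k * theta the i-th moment is prod_{j<i} (u + j * theta), so m_{j+1} = (u + j * theta) m_j
  and the 3 x d matrix with rows m_j, j m_j, m_{j+1} has rank at most 2 on the variety. Its maximal
  minors leave only the points of the surface parametrised by (u, theta) and the d lines joining the
  coordinate points e_i (i < d) to e_d; the lines are limits of the surface. Away from e_0 and e_d
  the differentials of the minors cut the tangent space of the affine cone down to dimension 3, while
  point < curve < variety is a chain of irreducible sets. At e_d the lines, and at e_0 the curves with
  theta constant, span a tangent space of dimension d >= 3. The dimension is at most 2: a chain of
  four irreducible sets would give three functions algebraically independent on the surface, but the
  (N + 1)^3 monomials in them of exponents at most N pull back to a space of polynomials in u and
  theta of dimension O(N^2).
*)

theory Submission
  imports Defs "HOL-Computational_Algebra.Polynomial"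
begin


section \<open>Evaluation and differentiation of polynomials\<close>

text \<open>The vanishing ideal of the variety is never determined. An upper bound for a tangent
  space needs only some elements of the ideal, and the minors are enough; a lower bound needs only
  curves inside the variety, whose velocities every element of the ideal annihilates. Limits are
  algebraic: a form evaluated along a polynomial curve is a polynomial in one variable, so vanishing
  for \<open>t \<noteq> 0\<close> forces vanishing at \<open>t = 0\<close>. The same reduction
  proves irreducibility, because the polynomials in one variable form a domain. The obstacle is the
  bound on chains, since their members are arbitrary irreducible sets about which nothing explicit
  is known. All that is kept of a member is one form that vanishes on the preceding member but not
  on it; primality is what makes such forms independent.\<close>

definition monom_eval :: "(nat \<Rightarrow>\<^sub>0 nat) \<Rightarrow> (nat \<Rightarrow> complex) \<Rightarrow> complex" where
  "monom_eval t x = (\<Prod>i\<in>Poly_Mapping.keys t. x i ^ Poly_Mapping.lookup t i)"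

text \<open>Unlike \<open>homogeneous\<close>, this names the degree, which has to be added up in
  products and serves as exponent when coordinates are rescaled. The zero polynomial is a form of
  every degree.\<close>

definition form :: "nat \<Rightarrow> nat \<Rightarrow> mpoly \<Rightarrow> bool" where
  "form d n f \<longleftrightarrow> f \<in> poly_ring d \<and> (\<forall>t\<in>Poly_Mapping.keys f.
      (\<Sum>i\<in>Poly_Mapping.keys t. Poly_Mapping.lookup t i) = n)"

definition const_poly :: "complex \<Rightarrow> mpoly" where
  "const_poly c = Poly_Mapping.single 0 c"

text \<open>The differential of \<open>f\<close> at \<open>x\<close> applied to \<open>v\<close>;
  \<open>cone_tangent_space\<close> is a common kernel of such linear forms.\<close>

definition directional :: "nat \<Rightarrow> mpoly \<Rightarrow> (nat \<Rightarrow> complex) \<Rightarrow> (nat \<Rightarrow> complex) \<Rightarrow> complex" where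
  "directional d f x v = (\<Sum>i\<le>d. peval (pdiff i f) x * v i)"

lemma peval_eq: "peval f x = (\<Sum>t\<in>Poly_Mapping.keys f. Poly_Mapping.lookup f t * monom_eval t x)"
  by (simp add: peval_def monom_eval_def)

lemma monom_eval_superset:
  assumes "finite A" "Poly_Mapping.keys t \<subseteq> A"
  shows "monom_eval t x = (\<Prod>i\<in>A. x i ^ Poly_Mapping.lookup t i)"
  unfolding monom_eval_def using assms
  by (intro prod.mono_neutral_left) (auto simp: in_keys_iff)

lemma monom_eval_add: "monom_eval (s + t) x = monom_eval s x * monom_eval t x"
proof -
  let ?A = "Poly_Mapping.keys s \<union> Poly_Mapping.keys t"
  have "monom_eval u x = (\<Prod>i\<in>?A. x i ^ Poly_Mapping.lookup u i)" if "u \<in> {s, t, s + t}" for u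
    using that by (intro monom_eval_superset) (use keys_add[of s t] in auto)
  then show ?thesis
    by (simp add: lookup_add power_add prod.distrib)
qed

lemma peval_superset:
  assumes "finite A" "Poly_Mapping.keys f \<subseteq> A"
  shows "peval f x = (\<Sum>t\<in>A. Poly_Mapping.lookup f t * monom_eval t x)"
  unfolding peval_eq using assms
  by (intro sum.mono_neutral_left) (auto simp: in_keys_iff)

lemma peval_add: "peval (f + g) x = peval f x + peval g x"
proof -
  let ?A = "Poly_Mapping.keys f \<union> Poly_Mapping.keys g"
  have "peval h x = (\<Sum>t\<in>?A. Poly_Mapping.lookup h t * monom_eval t x)" if "h \<in> {f, g, f + g}" for h
    using that by (intro peval_superset) (use keys_add[of f g] in auto)
  then show ?thesis
    by (simp add: lookup_add algebra_simps sum.distrib)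
qed

lemma peval_zero: "peval 0 x = 0"
  by (simp add: peval_eq)

lemma peval_sum: "peval (\<Sum>i\<in>I. f i) x = (\<Sum>i\<in>I. peval (f i) x)"
  by (induction I rule: infinite_finite_induct) (simp_all add: peval_zero peval_add)

lemma peval_single: "peval (Poly_Mapping.single t c) x = c * monom_eval t x"
  by (subst peval_superset[of "{t}"]) auto

lemma mpoly_expansion:
  fixes f :: mpoly
  shows "f = (\<Sum>t\<in>Poly_Mapping.keys f. Poly_Mapping.single t (Poly_Mapping.lookup f t))"
proof (rule poly_mapping_eqI)
  fix k
  have "(\<Sum>t\<in>Poly_Mapping.keys f. Poly_Mapping.lookup f t when t = k)
    = (if k \<in> Poly_Mapping.keys f then Poly_Mapping.lookup f k else 0)"
    by (simp add: when_def if_distrib sum.delta cong: if_cong)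
  then show "Poly_Mapping.lookup f k
    = Poly_Mapping.lookup (\<Sum>t\<in>Poly_Mapping.keys f. Poly_Mapping.single t (Poly_Mapping.lookup f t)) k"
    by (simp add: lookup_sum lookup_single in_keys_iff)
qed

lemma peval_mult: "peval (f * g) x = peval f x * peval g x"
proof -
  have "f * g = (\<Sum>s\<in>Poly_Mapping.keys f. Poly_Mapping.single s (Poly_Mapping.lookup f s)) *
                (\<Sum>t\<in>Poly_Mapping.keys g. Poly_Mapping.single t (Poly_Mapping.lookup g t))"
    using mpoly_expansion by metis
  also have "\<dots> = (\<Sum>s\<in>Poly_Mapping.keys f. \<Sum>t\<in>Poly_Mapping.keys g.
      Poly_Mapping.single (s + t) (Poly_Mapping.lookup f s * Poly_Mapping.lookup g t))"
    by (simp add: sum_product mult_single)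
  finally show ?thesis
    by (simp add: peval_sum peval_single monom_eval_add peval_eq[of f] peval_eq[of g] sum_product mult_ac)
qed

lemma peval_one: "peval 1 x = 1"
  using peval_single[of 0 1 x] by (simp add: monom_eval_def)

lemma peval_power: "peval (f ^ n) x = peval f x ^ n"
  by (induction n) (simp_all add: peval_one peval_mult)

lemma peval_const: "peval (const_poly c) x = c"
  by (simp add: const_poly_def peval_single monom_eval_def)

lemma peval_pvar: "peval (pvar i) x = x i"
  by (simp add: pvar_def peval_single monom_eval_def)

lemmas peval_simps = peval_add peval_mult peval_power peval_const peval_pvar peval_sum

lemma total_degree_add:
  fixes s t :: "nat \<Rightarrow>\<^sub>0 nat"
  shows "(\<Sum>i\<in>Poly_Mapping.keys (s + t). Poly_Mapping.lookup (s + t) i) =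
    (\<Sum>i\<in>Poly_Mapping.keys s. Poly_Mapping.lookup s i) + (\<Sum>i\<in>Poly_Mapping.keys t. Poly_Mapping.lookup t i)"
proof -
  let ?A = "Poly_Mapping.keys s \<union> Poly_Mapping.keys t"
  have "(\<Sum>i\<in>Poly_Mapping.keys u. Poly_Mapping.lookup u i) = (\<Sum>i\<in>?A. Poly_Mapping.lookup u i)"
    if "u \<in> {s, t, s + t}" for u
    using that by (intro sum.mono_neutral_left) (use keys_add[of s t] in \<open>auto simp: in_keys_iff\<close>)
  from this[of s] this[of t] this[of "s + t"] show ?thesis
    by (simp only: lookup_add sum.distrib insert_iff simp_thms)
qed

lemma form_add: "form d n f \<Longrightarrow> form d n g \<Longrightarrow> form d n (f + g)"
  unfolding form_def poly_ring_def using keys_add[of f g] by blast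

lemma form_zero: "form d n 0"
  by (simp add: form_def poly_ring_def)

lemma form_sum: "(\<And>i. i \<in> I \<Longrightarrow> form d n (f i)) \<Longrightarrow> form d n (\<Sum>i\<in>I. f i)"
  by (induction I rule: infinite_finite_induct) (simp_all add: form_zero form_add)

lemma form_mult:
  assumes "form d m f" "form d n g"
  shows "form d (m + n) (f * g)"
  unfolding form_def poly_ring_def
proof (intro conjI CollectI ballI)
  fix u assume "u \<in> Poly_Mapping.keys (f * g)"
  then obtain s t where u: "u = s + t" "s \<in> Poly_Mapping.keys f" "t \<in> Poly_Mapping.keys g"
    using keys_mult[of f g] by blast
  show "Poly_Mapping.keys u \<subseteq> {..d}"
    using assms u keys_add[of s t] by (fastforce simp: form_def poly_ring_def)
  show "(\<Sum>i\<in>Poly_Mapping.keys u. Poly_Mapping.lookup u i) = m + n"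
    using assms u by (auto simp: form_def total_degree_add)
qed

lemma form_const: "form d 0 (const_poly c)"
  by (auto simp: form_def poly_ring_def const_poly_def)

lemma form_one: "form d 0 1"
  using form_const[of d 1] by (simp add: const_poly_def)

lemma form_power: "form d n f \<Longrightarrow> form d (k * n) (f ^ k)"
  by (induction k) (simp_all add: form_one form_mult)

lemma form_pvar: "i \<le> d \<Longrightarrow> form d 1 (pvar i)"
  by (auto simp: form_def poly_ring_def pvar_def)

lemma form_iff: "f \<in> poly_ring d \<and> homogeneous f \<longleftrightarrow> (\<exists>n. form d n f)"
  by (auto simp: form_def homogeneous_def)

lemma poly_ring_mult:
  assumes "f \<in> poly_ring d" "g \<in> poly_ring d"
  shows "f * g \<in> poly_ring d"
  unfolding poly_ring_def
proof (intro CollectI ballI)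
  fix u assume "u \<in> Poly_Mapping.keys (f * g)"
  then obtain s t where u: "u = s + t" "s \<in> Poly_Mapping.keys f" "t \<in> Poly_Mapping.keys g"
    using keys_mult[of f g] by blast
  then show "Poly_Mapping.keys u \<subseteq> {..d}"
    using assms keys_add[of s t] by (fastforce simp: poly_ring_def)
qed

lemma poly_ring_add: "f \<in> poly_ring d \<Longrightarrow> g \<in> poly_ring d \<Longrightarrow> f + g \<in> poly_ring d"
  unfolding poly_ring_def using keys_add[of f g] by blast

lemma poly_ring_sum: "(\<And>i. i \<in> I \<Longrightarrow> f i \<in> poly_ring d) \<Longrightarrow> (\<Sum>i\<in>I. f i) \<in> poly_ring d"
  by (induction I rule: infinite_finite_induct) (auto simp: poly_ring_add, auto simp: poly_ring_def)

section \<open>Forms along rescalings and curves\<close>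

lemma peval_scale:
  assumes "form d n f"
  shows "peval f (\<lambda>i. c * x i) = c ^ n * peval f x"
  using assms unfolding peval_eq monom_eval_def sum_distrib_left form_def
  by (intro sum.cong) (auto simp: power_mult_distrib prod.distrib mult_ac simp flip: power_sum)

text \<open>The bridge to one variable: a polynomial \<open>p\<close> that vanishes at all but one
  point is zero, and a product of such polynomials is zero only if a factor is. Limit points and
  irreducibility both rest on this.\<close>

lemma peval_poly_curve:
  fixes \<gamma> :: "nat \<Rightarrow> complex poly"
  shows "\<exists>p. \<forall>t. peval f (\<lambda>i. poly (\<gamma> i) t) = poly p t"
proof -
  define p where "p = (\<Sum>t\<in>Poly_Mapping.keys f. smult (Poly_Mapping.lookup f t)
      (\<Prod>i\<in>Poly_Mapping.keys t. \<gamma> i ^ Poly_Mapping.lookup t i))"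
  show ?thesis
    by (intro exI[of _ p]) (simp add: p_def peval_def poly_sum poly_prod)
qed

lemma monom_eval_has_derivative:
  assumes t: "Poly_Mapping.keys t \<subseteq> {..d}"
    and \<gamma>: "\<And>i. i \<le> d \<Longrightarrow> ((\<lambda>z. \<gamma> z i) has_field_derivative \<gamma>' i) (at a)"
  shows "((\<lambda>z. monom_eval t (\<gamma> z)) has_field_derivative
    (\<Sum>i\<le>d. of_nat (Poly_Mapping.lookup t i) * monom_eval (t - Poly_Mapping.single i 1) (\<gamma> a) * \<gamma>' i)) (at a)"
proof -
  \<comment> \<open>No case distinction on whether variable \<open>i\<close> occurs in
    \<open>t\<close>: the subtraction of exponents truncates in the same way on both sides.\<close>
  have eq: "of_nat (Poly_Mapping.lookup t i) * \<gamma>' i * \<gamma> a i ^ (Poly_Mapping.lookup t i - 1) *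
      (\<Prod>j\<in>{..d} - {i}. \<gamma> a j ^ Poly_Mapping.lookup t j) =
      of_nat (Poly_Mapping.lookup t i) * monom_eval (t - Poly_Mapping.single i 1) (\<gamma> a) * \<gamma>' i"
    if "i \<le> d" for i
  proof -
    have "Poly_Mapping.keys (t - Poly_Mapping.single i 1) \<subseteq> Poly_Mapping.keys t"
      by (auto simp: in_keys_iff lookup_minus)
    with t have "monom_eval (t - Poly_Mapping.single i 1) (\<gamma> a) =
        (\<Prod>j\<le>d. \<gamma> a j ^ Poly_Mapping.lookup (t - Poly_Mapping.single i 1) j)"
      by (intro monom_eval_superset) auto
    also have "\<dots> = \<gamma> a i ^ (Poly_Mapping.lookup t i - 1) *
      (\<Prod>j\<in>{..d} - {i}. \<gamma> a j ^ Poly_Mapping.lookup t j)"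
      using that by (subst prod.remove[of _ i]) (auto simp: lookup_minus lookup_single intro!: prod.cong)
    finally show ?thesis by simp
  qed
  have "((\<lambda>z. \<Prod>i\<le>d. \<gamma> z i ^ Poly_Mapping.lookup t i) has_field_derivative
      (\<Sum>i\<le>d. of_nat (Poly_Mapping.lookup t i) * \<gamma>' i * \<gamma> a i ^ (Poly_Mapping.lookup t i - 1) *
      (\<Prod>j\<in>{..d} - {i}. \<gamma> a j ^ Poly_Mapping.lookup t j))) (at a)"
    by (rule has_field_derivative_prod) (auto intro!: derivative_eq_intros \<gamma>)
  moreover have "monom_eval t x = (\<Prod>i\<le>d. x i ^ Poly_Mapping.lookup t i)" for x
    using t by (intro monom_eval_superset) auto
  moreover have "(\<Sum>i\<le>d. of_nat (Poly_Mapping.lookup t i) * \<gamma>' i * \<gamma> a i ^ (Poly_Mapping.lookup t i - 1) *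
      (\<Prod>j\<in>{..d} - {i}. \<gamma> a j ^ Poly_Mapping.lookup t j)) =
      (\<Sum>i\<le>d. of_nat (Poly_Mapping.lookup t i) * monom_eval (t - Poly_Mapping.single i 1) (\<gamma> a) * \<gamma>' i)"
    by (intro sum.cong refl eq) simp
  ultimately show ?thesis
    by simp
qed

text \<open>The chain rule. It lets differentials be found by differentiating complex functions of
  one variable, in place of formal rules for \<open>pdiff\<close>.\<close>

lemma peval_has_derivative:
  assumes f: "f \<in> poly_ring d"
    and \<gamma>: "\<And>i. i \<le> d \<Longrightarrow> ((\<lambda>z. \<gamma> z i) has_field_derivative \<gamma>' i) (at a)"
  shows "((\<lambda>z. peval f (\<gamma> z)) has_field_derivative directional d f (\<gamma> a) \<gamma>') (at a)"
proof -
  have "((\<lambda>z. peval f (\<gamma> z)) has_field_derivative (\<Sum>t\<in>Poly_Mapping.keys f. Poly_Mapping.lookup f t *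
    (\<Sum>i\<le>d. of_nat (Poly_Mapping.lookup t i) * monom_eval (t - Poly_Mapping.single i 1) (\<gamma> a) * \<gamma>' i))) (at a)"
    unfolding peval_eq using f \<gamma>
    by (intro DERIV_sum DERIV_cmult monom_eval_has_derivative) (auto simp: poly_ring_def)
  also have "(\<Sum>t\<in>Poly_Mapping.keys f. Poly_Mapping.lookup f t *
    (\<Sum>i\<le>d. of_nat (Poly_Mapping.lookup t i) * monom_eval (t - Poly_Mapping.single i 1) (\<gamma> a) * \<gamma>' i))
     = directional d f (\<gamma> a) \<gamma>'"
    unfolding directional_def pdiff_def peval_sum peval_single sum_distrib_left sum_distrib_right
    by (subst sum.swap) (simp add: mult_ac)
  finally show ?thesis .
qed


section \<open>Zariski closed sets\<close>

definition vanishes_on :: "mpoly \<Rightarrow> ppoint set \<Rightarrow> bool" where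
  "vanishes_on f S \<longleftrightarrow> (\<forall>P\<in>S. \<forall>x\<in>P. peval f x = 0)"

lemma vanishes_on_subset: "vanishes_on f S \<Longrightarrow> T \<subseteq> S \<Longrightarrow> vanishes_on f T"
  by (auto simp: vanishes_on_def)

lemma hpoint_self: "x \<in> hpoint x"
  unfolding hpoint_def by (auto intro: exI[of _ 1])

lemma hpoint_scale:
  assumes "c \<noteq> 0"
  shows "hpoint (\<lambda>i. c * x i) = hpoint x"
proof (intro equalityI subsetI)
  fix y assume "y \<in> hpoint (\<lambda>i. c * x i)"
  then obtain b where "b \<noteq> 0" "y = (\<lambda>i. (b * c) * x i)"
    by (auto simp: hpoint_def mult.assoc)
  then show "y \<in> hpoint x"
    using assms unfolding hpoint_def by (intro CollectI exI[of _ "b * c"]) auto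
next
  fix y assume "y \<in> hpoint x"
  then obtain b where "b \<noteq> 0" "y = (\<lambda>i. b * x i)"
    by (auto simp: hpoint_def)
  then show "y \<in> hpoint (\<lambda>i. c * x i)"
    using assms unfolding hpoint_def by (intro CollectI exI[of _ "b / c"]) auto
qed

lemma peval_hpoint_zero:
  assumes "form d n f" "y \<in> hpoint x"
  shows "peval f y = 0 \<longleftrightarrow> peval f x = 0"
  using assms peval_scale[of d n f] by (auto simp: hpoint_def)

lemma vanishes_on_hpoints:
  assumes "form d n f"
  shows "vanishes_on f (hpoint ` X) \<longleftrightarrow> (\<forall>x\<in>X. peval f x = 0)"
  using peval_hpoint_zero[OF assms] hpoint_self by (fastforce simp: vanishes_on_def)

lemma proj_spaceE:
  assumes "P \<in> proj_space d" "x \<in> P"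
  shows "P = hpoint x" "x \<in> vecs d" "\<exists>i\<le>d. x i \<noteq> 0"
proof -
  obtain y where y: "P = hpoint y" "y \<in> vecs d" "\<exists>i. y i \<noteq> 0"
    using assms by (auto simp: proj_space_def)
  then obtain c where c: "c \<noteq> 0" "x = (\<lambda>i. c * y i)"
    using assms by (auto simp: hpoint_def)
  show "P = hpoint x"
    using y c hpoint_scale by simp
  show "x \<in> vecs d"
    using y c by (auto simp: vecs_def)
  show "\<exists>i\<le>d. x i \<noteq> 0"
    using y c by (auto simp: vecs_def) (metis not_le)
qed

lemma zariski_closed_Int_zeros:
  assumes "zariski_closed d A" "form d n f"
  shows "zariski_closed d (A \<inter> proj_zeros d {f})"
proof -
  obtain F where F: "F \<subseteq> poly_ring d" "\<forall>f\<in>F. homogeneous f" "A = proj_zeros d F"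
    using assms by (auto simp: zariski_closed_def)
  show ?thesis
    unfolding zariski_closed_def
    by (rule exI[of _ "insert f F"]) (use F assms(2) form_iff[of f d] in \<open>auto simp: proj_zeros_def\<close>)
qed

lemma zariski_closed_subset: "zariski_closed d A \<Longrightarrow> A \<subseteq> proj_space d"
  by (auto simp: zariski_closed_def proj_zeros_def)

lemma zariski_closed_separate:
  assumes "zariski_closed d A" "P \<in> proj_space d" "P \<notin> A"
  obtains n f where "form d n f" "vanishes_on f A" "\<And>x. x \<in> P \<Longrightarrow> peval f x \<noteq> 0"
proof -
  obtain F where F: "F \<subseteq> poly_ring d" "\<forall>f\<in>F. homogeneous f" "A = proj_zeros d F"
    using assms by (auto simp: zariski_closed_def)
  then obtain f y where f: "f \<in> F" "y \<in> P" "peval f y \<noteq> 0"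
    using assms by (auto simp: proj_zeros_def)
  obtain n where n: "form d n f"
    using F f form_iff[of f d] by auto
  show thesis
  proof (rule that[OF n])
    show "vanishes_on f A"
      using F f by (auto simp: vanishes_on_def proj_zeros_def)
    show "peval f x \<noteq> 0" if "x \<in> P" for x
      using peval_hpoint_zero[OF n, of y x] proj_spaceE(1)[OF assms(2) that] f(2,3) by auto
  qed
qed

lemma zariski_closed_form_zeros:
  "zariski_closed d {P \<in> proj_space d. \<forall>n f. form d n f \<longrightarrow> vanishes_on f S \<longrightarrow> (\<forall>x\<in>P. peval f x = 0)}"
  unfolding zariski_closed_def
proof (intro exI conjI)
  let ?F = "{f. (\<exists>n. form d n f) \<and> vanishes_on f S}"
  show "?F \<subseteq> poly_ring d" "\<forall>f\<in>?F. homogeneous f"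
    using form_iff by blast+
  show "{P \<in> proj_space d. \<forall>n f. form d n f \<longrightarrow> vanishes_on f S \<longrightarrow> (\<forall>x\<in>P. peval f x = 0)} = proj_zeros d ?F"
    unfolding proj_zeros_def by blast
qed

text \<open>Membership in a closure is thereby tested one form at a time. If \<open>S\<close> left
  projective space, no closed set would contain it and the hull would be the whole type.\<close>

lemma zariski_closure_altdef:
  assumes "S \<subseteq> proj_space d"
  shows "zariski_closure d S =
    {P \<in> proj_space d. \<forall>n f. form d n f \<longrightarrow> vanishes_on f S \<longrightarrow> (\<forall>x\<in>P. peval f x = 0)}" (is "_ = ?C")
  unfolding zariski_closure_def
proof (rule hull_unique)
  show "S \<subseteq> ?C"
    using assms by (auto simp: vanishes_on_def)
  show "zariski_closed d ?C"
    by (rule zariski_closed_form_zeros)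
  show "?C \<subseteq> T" if T: "S \<subseteq> T" "zariski_closed d T" for T
  proof
    fix P assume P: "P \<in> ?C"
    show "P \<in> T"
    proof (rule ccontr)
      assume "P \<notin> T"
      with T(2) P obtain n f where f: "form d n f" "vanishes_on f T" "\<And>x. x \<in> P \<Longrightarrow> peval f x \<noteq> 0"
        using zariski_closed_separate[of d T P] by blast
      moreover obtain x where "x \<in> P"
        using P hpoint_self by (auto simp: proj_space_def)
      ultimately show False
        using P vanishes_on_subset[OF f(2) T(1)] by blast
    qed
  qed
qed

lemma zariski_closed_closure:
  assumes "S \<subseteq> proj_space d"
  shows "zariski_closed d (zariski_closure d S)"
  unfolding zariski_closure_altdef[OF assms] by (rule zariski_closed_form_zeros)

lemma vanishes_on_closure:
  assumes "S \<subseteq> proj_space d" "form d n f" "vanishes_on f S"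
  shows "vanishes_on f (zariski_closure d S)"
  using assms by (auto simp: zariski_closure_altdef vanishes_on_def)

lemma closure_subset: "S \<subseteq> zariski_closure d S"
  by (simp add: zariski_closure_def hull_subset)

lemma closure_minimal: "S \<subseteq> T \<Longrightarrow> zariski_closed d T \<Longrightarrow> zariski_closure d S \<subseteq> T"
  by (simp add: zariski_closure_def hull_minimal)

section \<open>Irreducible sets\<close>

text \<open>The zeros of \<open>f\<close> and of \<open>g\<close> cut \<open>Z\<close> into two
  closed pieces that cover it, so one piece is all of \<open>Z\<close>.\<close>

lemma irreducible_closed_prime:
  assumes Z: "irreducible_closed d Z"
    and f: "form d m f" and g: "form d n g" and fg: "vanishes_on (f * g) Z"
  shows "vanishes_on f Z \<or> vanishes_on g Z"
proof -
  have cl: "zariski_closed d Z"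
    using Z by (simp add: irreducible_closed_def)
  have "P \<in> proj_zeros d {f} \<or> P \<in> proj_zeros d {g}" if P: "P \<in> Z" for P
  proof -
    have Ps: "P \<in> proj_space d"
      using P zariski_closed_subset[OF cl] by blast
    then obtain x where x: "x \<in> P"
      using hpoint_self by (auto simp: proj_space_def)
    note Px = proj_spaceE(1)[OF Ps x]
    have "peval f x = 0 \<or> peval g x = 0"
      using fg P x by (auto simp: vanishes_on_def peval_mult)
    then show ?thesis
      using peval_hpoint_zero[OF f, of _ x] peval_hpoint_zero[OF g, of _ x] Ps Px
      by (auto simp: proj_zeros_def)
  qed
  then have "Z = (Z \<inter> proj_zeros d {f}) \<union> (Z \<inter> proj_zeros d {g})"
    by blast
  then have "Z = Z \<inter> proj_zeros d {f} \<or> Z = Z \<inter> proj_zeros d {g}"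
    using Z zariski_closed_Int_zeros[OF cl f] zariski_closed_Int_zeros[OF cl g]
    unfolding irreducible_closed_def by blast
  then show ?thesis
    by (auto simp: vanishes_on_def proj_zeros_def)
qed

lemma hpoint_image_subset:
  assumes "X \<subseteq> vecs d" "\<And>x. x \<in> X \<Longrightarrow> \<exists>i. x i \<noteq> 0"
  shows "hpoint ` X \<subseteq> proj_space d"
  using assms by (auto simp: proj_space_def)

text \<open>If the closure were the union of proper closed parts \<open>A\<close> and
  \<open>B\<close>, some \<open>f\<close> would vanish on \<open>A\<close> but not at a point
  \<open>a\<close> of \<open>X\<close>, and some \<open>g\<close> on \<open>B\<close> but not at a
  point \<open>b\<close>. Along a curve in \<open>X\<close> from \<open>a\<close> to
  \<open>b\<close> the product of the two is identically zero, although \<open>f\<close> is nonzero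
  at the start and \<open>g\<close> at the end.\<close>

lemma irreducible_closure:
  assumes X: "X \<subseteq> vecs d" "\<And>x. x \<in> X \<Longrightarrow> \<exists>i. x i \<noteq> 0" "X \<noteq> {}"
    and curve: "\<And>a b. a \<in> X \<Longrightarrow> b \<in> X \<Longrightarrow> \<exists>\<gamma> :: nat \<Rightarrow> complex poly.
      (\<forall>t. (\<lambda>i. poly (\<gamma> i) t) \<in> X) \<and> (\<lambda>i. poly (\<gamma> i) 0) = a \<and> (\<lambda>i. poly (\<gamma> i) 1) = b"
  shows "irreducible_closed d (zariski_closure d (hpoint ` X))" (is "irreducible_closed d ?Z")
proof -
  have sub: "hpoint ` X \<subseteq> proj_space d"
    using X hpoint_image_subset by blast
  have "?Z = A \<or> ?Z = B"
    if AB: "zariski_closed d A" "zariski_closed d B" "?Z = A \<union> B" for A B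
  proof (rule ccontr)
    assume neg: "\<not> (?Z = A \<or> ?Z = B)"
    have ex: "\<exists>n f a. form d n f \<and> vanishes_on f C \<and> a \<in> X \<and> peval f a \<noteq> 0"
      if C: "zariski_closed d C" "C \<subseteq> ?Z" "?Z \<noteq> C" for C
    proof -
      have "\<not> hpoint ` X \<subseteq> C"
        using C closure_minimal[of "hpoint ` X" C d] by blast
      then obtain a where a: "a \<in> X" "hpoint a \<notin> C"
        by blast
      obtain n f where "form d n f" "vanishes_on f C" "\<And>x. x \<in> hpoint a \<Longrightarrow> peval f x \<noteq> 0"
        using zariski_closed_separate[OF C(1) _ a(2)] sub a(1) by blast
      then show ?thesis
        using a hpoint_self by blast
    qed
    obtain m f a where f: "form d m f" "vanishes_on f A" "a \<in> X" "peval f a \<noteq> 0"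
      using ex[of A] AB neg by blast
    obtain n g b where g: "form d n g" "vanishes_on g B" "b \<in> X" "peval g b \<noteq> 0"
      using ex[of B] AB neg by blast
    obtain \<gamma> :: "nat \<Rightarrow> complex poly" where \<gamma>: "\<And>t. (\<lambda>i. poly (\<gamma> i) t) \<in> X"
      "(\<lambda>i. poly (\<gamma> i) 0) = a" "(\<lambda>i. poly (\<gamma> i) 1) = b"
      using curve[OF f(3) g(3)] by blast
    obtain p where p: "\<And>t. peval f (\<lambda>i. poly (\<gamma> i) t) = poly p t"
      using peval_poly_curve by blast
    obtain q where q: "\<And>t. peval g (\<lambda>i. poly (\<gamma> i) t) = poly q t"
      using peval_poly_curve by blast
    have "poly (p * q) t = 0" for t
    proof -
      have "hpoint (\<lambda>i. poly (\<gamma> i) t) \<in> A \<union> B"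
        using \<gamma>(1)[of t] closure_subset[of "hpoint ` X" d] AB(3) by blast
      then have "peval f (\<lambda>i. poly (\<gamma> i) t) = 0 \<or> peval g (\<lambda>i. poly (\<gamma> i) t) = 0"
        using f(2) g(2) hpoint_self unfolding vanishes_on_def by blast
      then show ?thesis
        by (simp add: p q)
    qed
    then have "p * q = 0"
      by (metis poly_all_0_iff_0)
    then show False
      using f(4) g(4) p[of 0] q[of 1] \<gamma>(2,3) by auto
  qed
  moreover have "?Z \<noteq> {}"
    using X(3) closure_subset[of "hpoint ` X" d] by blast
  ultimately show ?thesis
    unfolding irreducible_closed_def using zariski_closed_closure[OF sub] by blast
qed

text \<open>A point is cut out by the linear forms \<open>x k * y j - x j * y k\<close> in
  \<open>y\<close>, for one fixed \<open>k\<close> with \<open>x k \<noteq> 0\<close>.\<close>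

lemma closure_point:
  assumes x: "x \<in> vecs d" "\<exists>i. x i \<noteq> 0"
  shows "zariski_closure d {hpoint x} = {hpoint x}"
proof
  have sub: "{hpoint x} \<subseteq> proj_space d"
    using hpoint_image_subset[of "{x}" d] x by auto
  obtain k where k: "x k \<noteq> 0"
    using x by blast
  then have kd: "k \<le> d"
    using x(1) by (auto simp: vecs_def not_le[symmetric])
  show "zariski_closure d {hpoint x} \<subseteq> {hpoint x}"
  proof
    fix P assume P: "P \<in> zariski_closure d {hpoint x}"
    then have Ps: "P \<in> proj_space d"
      using zariski_closed_subset[OF zariski_closed_closure[OF sub]] by blast
    then obtain y where y: "y \<in> P"
      using hpoint_self by (auto simp: proj_space_def)
    note yP = proj_spaceE[OF Ps y]
    have eq: "x k * y j = x j * y k" if "j \<le> d" for j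
    proof -
      let ?f = "const_poly (x k) * pvar j + const_poly (- x j) * pvar k"
      have "form d (0 + 1) ?f"
        using that kd by (intro form_add form_mult form_const form_pvar)
      moreover from this have "vanishes_on ?f {hpoint x}"
        using vanishes_on_hpoints[of d 1 ?f "{x}"] by (simp add: peval_simps)
      ultimately have "vanishes_on ?f (zariski_closure d {hpoint x})"
        using vanishes_on_closure[OF sub] by blast
      with P y show ?thesis
        by (auto simp: vanishes_on_def peval_simps)
    qed
    have yk: "y k \<noteq> 0"
      using yP(3) eq k by fastforce
    have "y = (\<lambda>j. y k / x k * x j)"
    proof
      fix j show "y j = y k / x k * x j"
      proof (cases "j \<le> d")
        case True
        then show ?thesis
          using eq[OF True] k by (simp add: field_simps)
      qed (use yP(2) x(1) in \<open>simp add: vecs_def\<close>)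
    qed
    then have "hpoint y = hpoint x"
      using hpoint_scale[of "y k / x k" x] yk k by simp
    then show "P \<in> {hpoint x}"
      using yP(1) by simp
  qed
qed (rule closure_subset)

lemma irreducible_point:
  assumes "x \<in> vecs d" "\<exists>i. x i \<noteq> 0"
  shows "irreducible_closed d {hpoint x}"
proof -
  have "irreducible_closed d (zariski_closure d (hpoint ` {x}))"
    by (rule irreducible_closure) (use assms in \<open>auto intro!: exI[of _ "\<lambda>i. [:x i:]"]\<close>)
  then show ?thesis
    using closure_point[OF assms] by simp
qed

lemma form_in_vanishing_ideal:
  assumes "form d n f" "vanishes_on f X"
  shows "f \<in> vanishing_ideal d X"
proof -
  have "1 \<in> poly_ring d"
    using form_one[of d] by (simp add: form_def)
  moreover have "f = (\<Sum>b\<in>{f}. 1 * b)"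
    by simp
  ultimately show ?thesis
    using assms form_iff[of f d] unfolding vanishing_ideal_def ideal_gen_def vanishes_on_def
    by (intro CollectI exI[of _ "{f}"] exI[of _ "\<lambda>_. 1"]) auto
qed

lemma vanishing_idealD:
  assumes "f \<in> vanishing_ideal d X"
  shows "f \<in> poly_ring d" "vanishes_on f X"
proof -
  obtain S c where S: "f = (\<Sum>b\<in>S. c b * b)" "\<forall>b\<in>S. c b \<in> poly_ring d"
     "\<forall>b\<in>S. b \<in> poly_ring d \<and> vanishes_on b X"
    using assms unfolding vanishing_ideal_def ideal_gen_def vanishes_on_def by blast
  show "f \<in> poly_ring d"
    using S by (auto intro!: poly_ring_sum poly_ring_mult)
  show "vanishes_on f X"
    using S by (auto simp: vanishes_on_def peval_simps intro!: sum.neutral)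
qed


section \<open>Chains of irreducible subsets of a parametrised surface\<close>

text \<open>Gaussian elimination, one equation per induction step. It serves twice: for the bound on
  the dimension of a subspace and for the linear relation between monomials.\<close>

lemma underdetermined_system:
  fixes A :: "'i \<Rightarrow> 'j \<Rightarrow> 'a::field"
  assumes "finite J" "finite I" "card J < card I"
  shows "\<exists>c. (\<exists>i\<in>I. c i \<noteq> 0) \<and> (\<forall>j\<in>J. (\<Sum>i\<in>I. c i * A i j) = 0)"
  using assms
proof (induction J arbitrary: I A rule: finite_induct)
  case empty
  then have "I \<noteq> {}" by auto
  then show ?case by (intro exI[of _ "\<lambda>_. 1"]) auto
next
  case (insert j J)
  show ?case
  proof (cases "\<forall>i\<in>I. A i j = 0")
    case True
    then show ?thesis
      using insert.IH[of I A] insert.prems insert.hyps by auto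
  next
    case False
    then obtain k where k: "k \<in> I" "A k j \<noteq> 0" by blast
    \<comment> \<open>The remaining equations after the pivot unknown \<open>k\<close> has been
      eliminated by means of equation \<open>j\<close>.\<close>
    define B where "B i l = A i l - A i j / A k j * A k l" for i l
    have "card J < card (I - {k})"
      using insert.prems insert.hyps k by simp
    then obtain c where c: "\<exists>i\<in>I - {k}. c i \<noteq> 0" "\<forall>l\<in>J. (\<Sum>i\<in>I - {k}. c i * B i l) = 0"
      using insert.IH[of "I - {k}" B] insert.prems by auto
    \<comment> \<open>The value at \<open>k\<close> is the one that equation \<open>j\<close>
      forces.\<close>
    define e where "e i = (if i = k then - (\<Sum>i\<in>I - {k}. c i * (A i j / A k j)) else c i)" for i
    have eq: "(\<Sum>i\<in>I. e i * A i l) = (\<Sum>i\<in>I - {k}. c i * B i l)" for l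
    proof -
      have "(\<Sum>i\<in>I. e i * A i l) = e k * A k l + (\<Sum>i\<in>I - {k}. c i * A i l)"
        using k insert.prems by (subst sum.remove[of _ k]) (auto simp: e_def intro!: sum.cong)
      also have "\<dots> = (\<Sum>i\<in>I - {k}. c i * A i l) - (\<Sum>i\<in>I - {k}. c i * (A i j / A k j) * A k l)"
        by (simp add: e_def sum_distrib_right)
      also have "\<dots> = (\<Sum>i\<in>I - {k}. c i * B i l)"
        unfolding B_def sum_subtractf[symmetric] by (intro sum.cong) (auto simp: algebra_simps)
      finally show ?thesis .
    qed
    have "B i j = 0" for i
      using k by (simp add: B_def)
    then have "\<forall>l\<in>insert j J. (\<Sum>i\<in>I. e i * A i l) = 0"
      unfolding eq using c(2) by auto
    moreover have "\<exists>i\<in>I. e i \<noteq> 0"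
      using c(1) by (auto simp: e_def)
    ultimately show ?thesis by blast
  qed
qed

interpretation vec: vector_space vec_scale
  by (rule vector_space_vec_scale)

lemma sum_vec_scale_apply: "(\<Sum>b\<in>B. vec_scale (c b) (f b)) i = (\<Sum>b\<in>B. c b * f b i)"
  by (induction B rule: infinite_finite_induct) (auto simp: vec_scale_def)

text \<open>Projection to the coordinates in \<open>I\<close> is injective on \<open>W\<close>: more
  than \<open>card I\<close> basis vectors would have a nontrivial combination whose coordinates in
  \<open>I\<close> all vanish.\<close>

lemma vec_dim_le:
  assumes W: "vec.subspace W" and I: "finite I"
    and inj: "\<And>v. v \<in> W \<Longrightarrow> (\<And>i. i \<in> I \<Longrightarrow> v i = 0) \<Longrightarrow> v = 0"
  shows "vec.dim W \<le> card I"
proof (rule ccontr)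
  assume "\<not> vec.dim W \<le> card I"
  obtain B where B: "B \<subseteq> W" "vec.independent B" "W \<subseteq> vec.span B" "card B = vec.dim W"
    by (rule vec.basis_exists)
  with \<open>\<not> vec.dim W \<le> card I\<close> have less: "card I < card B"
    by simp
  \<comment> \<open>An infinite basis would have \<open>card B = 0\<close>, which
    \<open>less\<close> excludes.\<close>
  then have fin: "finite B"
    using card.infinite by fastforce
  obtain c where c: "\<exists>b\<in>B. c b \<noteq> 0" "\<forall>i\<in>I. (\<Sum>b\<in>B. c b * b i) = 0"
    using underdetermined_system[OF I fin less, of "\<lambda>b i. b i"] by blast
  have "(\<Sum>b\<in>B. vec_scale (c b) b) = 0"
    using c(2) B(1) W
    by (intro inj) (auto simp: sum_vec_scale_apply intro!: vec.subspace_sum vec.subspace_scale)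
  then show False
    using vec.independentD[OF B(2) fin order.refl] c(1) by blast
qed

lemma vec_dim_vecs: "vec.dim (vecs d) = d + 1"
proof -
  define e :: "nat \<Rightarrow> nat \<Rightarrow> complex" where "e i = (\<lambda>j. if j = i then 1 else 0)" for i
  have inj: "inj_on e {..d}"
    by (auto simp: inj_on_def e_def fun_eq_iff)
  have sum_e: "(\<Sum>b\<in>e ` {..d}. vec_scale (c b) b) j = (if j \<le> d then c (e j) else 0)" for c j
  proof -
    have "(\<Sum>b\<in>e ` {..d}. vec_scale (c b) b) j = (\<Sum>i\<le>d. c (e i) * e i j)"
      by (simp add: sum_vec_scale_apply sum.reindex[OF inj])
    also have "\<dots> = (\<Sum>i\<le>d. if i = j then c (e i) else 0)"
      by (intro sum.cong) (auto simp: e_def)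
    finally show ?thesis
      by simp
  qed
  have ind: "vec.independent (e ` {..d})"
  proof (rule vec.independent_if_scalars_zero)
    fix c x assume c: "(\<Sum>x\<in>e ` {..d}. vec_scale (c x) x) = 0" and x: "x \<in> e ` {..d}"
    then obtain j where "j \<le> d" "x = e j" by auto
    then show "c x = 0"
      using sum_e[of c j] c by simp
  qed simp
  have "vec.span (e ` {..d}) = vec.span (vecs d)"
  proof
    show "vec.span (e ` {..d}) \<subseteq> vec.span (vecs d)"
      by (rule vec.span_mono) (auto simp: e_def vecs_def)
    have "v \<in> vec.span (e ` {..d})" if v: "v \<in> vecs d" for v
    proof -
      define c where "c b = v (the_inv_into {..d} e b)" for b
      have "v = (\<Sum>b\<in>e ` {..d}. vec_scale (c b) b)"
      proof
        fix j show "v j = (\<Sum>b\<in>e ` {..d}. vec_scale (c b) b) j"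
          unfolding sum_e using v by (auto simp: c_def the_inv_into_f_f[OF inj] vecs_def)
      qed
      then show ?thesis
        by (metis (no_types, lifting) vec.span_base vec.span_scale vec.span_sum)
    qed
    then show "vec.span (vecs d) \<subseteq> vec.span (e ` {..d})"
      using vec.span_minimal[OF _ vec.subspace_span] by blast
  qed
  then show ?thesis
    using vec.dim_eq_card[OF _ ind] card_image[OF inj] by simp
qed

section \<open>Pulling forms back to the parameter plane\<close>

definition gamma_vec :: "nat \<Rightarrow> complex \<Rightarrow> complex \<Rightarrow> nat \<Rightarrow> complex" where
  "gamma_vec d u \<theta> = (\<lambda>i. if i \<le> d then \<Prod>j<i. u + of_nat j * \<theta> else 0)"

text \<open>A polynomial function given by its values and some array of coefficients. Bounding the
  two exponents separately makes the index set a square with \<open>(K + 1)\<^sup>2\<close>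
  elements, one linear condition each in the counting argument.\<close>

definition bidegree_le :: "nat \<Rightarrow> (complex \<Rightarrow> complex \<Rightarrow> complex) \<Rightarrow> bool" where
  "bidegree_le K F \<longleftrightarrow> (\<exists>A. \<forall>u \<theta>. F u \<theta> = (\<Sum>p\<in>{..K} \<times> {..K}. A p * (u ^ fst p * \<theta> ^ snd p)))"

lemma bidegree_le_monom:
  assumes "a \<le> K" "b \<le> K"
  shows "bidegree_le K (\<lambda>u \<theta>. c * (u ^ a * \<theta> ^ b))"
  unfolding bidegree_le_def
proof (intro exI[of _ "\<lambda>p. if p = (a, b) then c else 0"] allI)
  fix u \<theta> :: complex
  have "(\<Sum>p\<in>{..K} \<times> {..K}. (if p = (a, b) then c else 0) * (u ^ fst p * \<theta> ^ snd p)) =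
    (\<Sum>p\<in>{..K} \<times> {..K}. if p = (a, b) then c * (u ^ a * \<theta> ^ b) else 0)"
    by (intro sum.cong) auto
  then show "c * (u ^ a * \<theta> ^ b) =
      (\<Sum>p\<in>{..K} \<times> {..K}. (if p = (a, b) then c else 0) * (u ^ fst p * \<theta> ^ snd p))"
    using assms by simp
qed

lemma bidegree_le_add:
  assumes "bidegree_le K F" "bidegree_le K G"
  shows "bidegree_le K (\<lambda>u \<theta>. F u \<theta> + G u \<theta>)"
proof -
  obtain A B where
    "\<And>u \<theta>. F u \<theta> = (\<Sum>p\<in>{..K} \<times> {..K}. A p * (u ^ fst p * \<theta> ^ snd p))"
    "\<And>u \<theta>. G u \<theta> = (\<Sum>p\<in>{..K} \<times> {..K}. B p * (u ^ fst p * \<theta> ^ snd p))"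
    using assms unfolding bidegree_le_def by blast
  then show ?thesis
    unfolding bidegree_le_def
    by (intro exI[of _ "\<lambda>p. A p + B p"]) (simp add: distrib_right sum.distrib)
qed

lemma bidegree_le_sum:
  "(\<And>i. i \<in> I \<Longrightarrow> bidegree_le K (F i)) \<Longrightarrow> bidegree_le K (\<lambda>u \<theta>. \<Sum>i\<in>I. F i u \<theta>)"
proof (induction I rule: infinite_finite_induct)
  case (insert i I)
  then show ?case
    by (simp add: bidegree_le_add)
qed (use bidegree_le_monom[of 0 K 0 0] in simp_all)

lemma bidegree_le_mult:
  assumes "bidegree_le K F" "bidegree_le L G"
  shows "bidegree_le (K + L) (\<lambda>u \<theta>. F u \<theta> * G u \<theta>)"
proof -
  obtain A B where
    "\<And>u \<theta>. F u \<theta> = (\<Sum>p\<in>{..K} \<times> {..K}. A p * (u ^ fst p * \<theta> ^ snd p))"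
    "\<And>u \<theta>. G u \<theta> = (\<Sum>p\<in>{..L} \<times> {..L}. B p * (u ^ fst p * \<theta> ^ snd p))"
    using assms unfolding bidegree_le_def by blast
  then have eq: "(\<lambda>u \<theta>. F u \<theta> * G u \<theta>) = (\<lambda>u \<theta>. \<Sum>p\<in>{..K} \<times> {..K}. \<Sum>q\<in>{..L} \<times> {..L}.
      (A p * B q) * (u ^ (fst p + fst q) * \<theta> ^ (snd p + snd q)))"
    by (simp add: sum_product power_add mult_ac)
  show ?thesis
    unfolding eq by (intro bidegree_le_sum bidegree_le_monom) auto
qed

lemma bidegree_le_prod:
  "(\<And>i. i \<in> I \<Longrightarrow> bidegree_le (k i) (F i)) \<Longrightarrow> bidegree_le (\<Sum>i\<in>I. k i) (\<lambda>u \<theta>. \<Prod>i\<in>I. F i u \<theta>)"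
proof (induction I rule: infinite_finite_induct)
  case (insert i I)
  then show ?case
    by (simp add: bidegree_le_mult)
qed (use bidegree_le_monom[of 0 0 0 1] in simp_all)

lemma bidegree_le_mono:
  assumes "bidegree_le K F" "K \<le> L"
  shows "bidegree_le L F"
proof -
  obtain A where eq:
    "F = (\<lambda>u \<theta>. \<Sum>p\<in>{..K} \<times> {..K}. A p * (u ^ fst p * \<theta> ^ snd p))"
    using assms unfolding bidegree_le_def by blast
  show ?thesis
    unfolding eq using assms(2) by (intro bidegree_le_sum bidegree_le_monom) auto
qed

lemma bidegree_le_gamma_vec:
  assumes "i \<le> d"
  shows "bidegree_le i (\<lambda>u \<theta>. gamma_vec d u \<theta> i)"
proof -
  have "bidegree_le 1 (\<lambda>u \<theta>. u + of_nat j * \<theta>)" for j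
    using bidegree_le_add[OF bidegree_le_monom[of 1 1 0 1] bidegree_le_monom[of 0 1 1 "of_nat j"]]
    by simp
  then have "bidegree_le (\<Sum>j<i. 1) (\<lambda>u \<theta>. \<Prod>j<i. u + of_nat j * \<theta>)"
    by (intro bidegree_le_prod)
  then show ?thesis
    using assms by (simp add: gamma_vec_def)
qed

text \<open>Coordinate \<open>i\<close> has degree \<open>i \<le> d\<close> in the parameters, so
  the substitution multiplies degrees by at most \<open>d\<close>.\<close>

lemma bidegree_le_form:
  assumes f: "form d n f"
  shows "bidegree_le (d * n) (\<lambda>u \<theta>. peval f (gamma_vec d u \<theta>))"
  unfolding peval_def
proof (intro bidegree_le_sum)
  fix t assume t: "t \<in> Poly_Mapping.keys f"
  have td: "Poly_Mapping.keys t \<subseteq> {..d}" and tn: "(\<Sum>i\<in>Poly_Mapping.keys t. Poly_Mapping.lookup t i) = n"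
    using f t by (auto simp: form_def poly_ring_def)
  have "bidegree_le (m * i) (\<lambda>u \<theta>. gamma_vec d u \<theta> i ^ m)" if "i \<le> d" for i m
    using bidegree_le_prod[of "{..<m}" "\<lambda>_. i" "\<lambda>_ u \<theta>. gamma_vec d u \<theta> i",
        OF bidegree_le_gamma_vec[OF that]] by simp
  then have "bidegree_le (\<Sum>i\<in>Poly_Mapping.keys t. Poly_Mapping.lookup t i * i)
      (\<lambda>u \<theta>. \<Prod>i\<in>Poly_Mapping.keys t. gamma_vec d u \<theta> i ^ Poly_Mapping.lookup t i)"
    using td by (intro bidegree_le_prod) auto
  moreover have "(\<Sum>i\<in>Poly_Mapping.keys t. Poly_Mapping.lookup t i * i) \<le> d * n"
    unfolding tn[symmetric] sum_distrib_left using td by (intro sum_mono) auto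
  ultimately have "bidegree_le (0 + d * n) (\<lambda>u \<theta>. Poly_Mapping.lookup f t * (u ^ 0 * \<theta> ^ 0) *
      (\<Prod>i\<in>Poly_Mapping.keys t. gamma_vec d u \<theta> i ^ Poly_Mapping.lookup t i))"
    by (intro bidegree_le_mult bidegree_le_monom) (auto intro: bidegree_le_mono)
  then show "bidegree_le (d * n) (\<lambda>u \<theta>. Poly_Mapping.lookup f t *
      (\<Prod>i\<in>Poly_Mapping.keys t. gamma_vec d u \<theta> i ^ Poly_Mapping.lookup t i))"
    by simp
qed

section \<open>Homogenised relations along a chain\<close>

text \<open>A polynomial in \<open>f\<close> homogenised to degree \<open>T\<close>;
  \<open>N * n \<le> T\<close> keeps the differences \<open>T - c * n\<close> from
  truncating.\<close>

lemma form_power_sum: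
  assumes "form d n f" "\<And>c. c \<le> N \<Longrightarrow> form d (T - c * n) (g c)" "N * n \<le> T"
  shows "form d T (\<Sum>c\<le>N. f ^ c * g c)"
proof (rule form_sum)
  fix c assume "c \<in> {..N}"
  then have "c * n \<le> T"
    using assms(3) by (meson atMost_iff mult_le_mono1 le_trans)
  then show "form d T (f ^ c * g c)"
    using form_mult[OF form_power[OF assms(1), of c] assms(2)[of c]] \<open>c \<in> {..N}\<close> by simp
qed

text \<open>The sum is \<open>f ^ c0\<close> times a form \<open>h\<close>. Since \<open>f\<close>
  does not vanish on the irreducible \<open>Z\<close>, primality makes \<open>h\<close> vanish
  there. On \<open>W\<close>, where \<open>f\<close> is zero, only the term \<open>g c0\<close> of
  \<open>h\<close> survives.\<close>

lemma leading_term_vanishes: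
  assumes Z: "irreducible_closed d Z" "W \<subseteq> Z"
    and f: "form d n f" "vanishes_on f W" "\<not> vanishes_on f Z"
    and g: "\<And>c. c \<le> N \<Longrightarrow> form d (T - c * n) (g c)" "N * n \<le> T"
    and c0: "c0 \<le> N" "\<And>c. c < c0 \<Longrightarrow> g c = 0"
    and van: "vanishes_on (\<Sum>c\<le>N. f ^ c * g c) Z"
  shows "vanishes_on (g c0) W"
proof -
  let ?h = "\<Sum>c\<in>{c0..N}. f ^ (c - c0) * g c"
  have "(\<Sum>c\<le>N. f ^ c * g c) = (\<Sum>c\<in>{c0..N}. f ^ c * g c)"
    using c0 by (intro sum.mono_neutral_right) auto
  also have "\<dots> = f ^ c0 * ?h"
    unfolding sum_distrib_left by (intro sum.cong) (auto simp flip: mult.assoc power_add)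
  finally have eq: "(\<Sum>c\<le>N. f ^ c * g c) = f ^ c0 * ?h" .
  have h: "form d (T - c0 * n) ?h"
  proof (rule form_sum)
    fix c assume c: "c \<in> {c0..N}"
    have "c * n \<le> T"
      using g(2) c by (meson atLeastAtMost_iff mult_le_mono1 le_trans)
    then have "(c - c0) * n + (T - c * n) = T - c0 * n"
      using c by (simp add: diff_mult_distrib)
    then show "form d (T - c0 * n) (f ^ (c - c0) * g c)"
      using form_mult[OF form_power[OF f(1), of "c - c0"] g(1)[of c]] c by simp
  qed
  have "\<not> vanishes_on (f ^ c0) Z"
    using f(3) by (auto simp: vanishes_on_def peval_power)
  then have "vanishes_on ?h Z"
    using irreducible_closed_prime[OF Z(1) form_power[OF f(1)] h] van eq by auto
  then have "vanishes_on ?h W"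
    using Z(2) vanishes_on_subset by blast
  moreover have "peval ?h x = peval (g c0) x" if "P \<in> W" "x \<in> P" for P x
  proof -
    have "peval f x = 0"
      using that f(2) by (auto simp: vanishes_on_def)
    then have "peval (f ^ (c - c0) * g c) x = (if c = c0 then peval (g c0) x else 0)" if "c \<ge> c0" for c
      using that by (simp add: peval_simps)
    then have "peval ?h x = (\<Sum>c\<in>{c0..N}. if c = c0 then peval (g c0) x else 0)"
      unfolding peval_sum by (intro sum.cong) auto
    then show ?thesis
      using c0 by simp
  qed
  ultimately show ?thesis
    by (auto simp: vanishes_on_def)
qed

lemma separating_form:
  assumes "zariski_closed d A" "A \<subset> B" "B \<subseteq> proj_space d"
  shows "\<exists>n f. form d n f \<and> vanishes_on f A \<and> \<not> vanishes_on f B"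
proof -
  obtain P where P: "P \<in> B" "P \<notin> A"
    using assms by blast
  then obtain n f where f: "form d n f" "vanishes_on f A" "\<And>x. x \<in> P \<Longrightarrow> peval f x \<noteq> 0"
    using zariski_closed_separate[OF assms(1)] assms(3) by (metis subsetD)
  moreover obtain x where "x \<in> P"
    using P assms(3) hpoint_self by (auto simp: proj_space_def)
  ultimately have "\<not> vanishes_on f B"
    unfolding vanishes_on_def using P(1) by blast
  with f show ?thesis
    by blast
qed

text \<open>Each \<open>f\<^sub>i\<close> vanishes on \<open>Z\<^sub>i\<^sub>-\<^sub>1\<close> but not on \<open>Z\<^sub>i\<close>, and \<open>l\<close> is a coordinate that does not vanish
  on \<open>Z\<^sub>0\<close>; powers of \<open>l\<close> homogenise the monomials in \<open>f\<^sub>1, f\<^sub>2, f\<^sub>3\<close> to a common degree \<open>T\<close>. In a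
  linear relation between them the lowest power of \<open>f\<^sub>3\<close> is cancelled on \<open>Z\<^sub>3\<close> and the rest restricted to
  \<open>Z\<^sub>2\<close>, and so on down to \<open>Z\<^sub>0\<close>.\<close>

lemma parametrised_surface_chain:
  assumes irr: "irreducible_closed d Z0" "irreducible_closed d Z1" "irreducible_closed d Z2"
      "irreducible_closed d Z3"
    and sub: "Z0 \<subset> Z1" "Z1 \<subset> Z2" "Z2 \<subset> Z3"
    and par: "\<And>n f. form d n f \<Longrightarrow> (\<And>u \<theta>. peval f (gamma_vec d u \<theta>) = 0) \<Longrightarrow> vanishes_on f Z3"
  shows False
proof -
  have cl: "zariski_closed d Z" "Z \<subseteq> proj_space d" if "Z \<in> {Z0, Z1, Z2, Z3}" for Z
  proof -
    show "zariski_closed d Z" using that irr by (auto simp: irreducible_closed_def)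
    then show "Z \<subseteq> proj_space d" by (rule zariski_closed_subset)
  qed
  obtain n1 f1 where f1: "form d n1 f1" "vanishes_on f1 Z0" "\<not> vanishes_on f1 Z1"
    using separating_form[of d Z0 Z1] sub cl by auto
  obtain n2 f2 where f2: "form d n2 f2" "vanishes_on f2 Z1" "\<not> vanishes_on f2 Z2"
    using separating_form[of d Z1 Z2] sub cl by auto
  obtain n3 f3 where f3: "form d n3 f3" "vanishes_on f3 Z2" "\<not> vanishes_on f3 Z3"
    using separating_form[of d Z2 Z3] sub cl by auto
  obtain P where P: "P \<in> Z0"
    using irr(1) by (auto simp: irreducible_closed_def)
  with cl[of Z0] obtain x where x: "x \<in> P"
    using hpoint_self by (auto simp: proj_space_def)
  obtain k where k: "k \<le> d" "x k \<noteq> 0"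
    using proj_spaceE(3)[OF _ x] P cl[of Z0] by blast
  let ?l = "pvar k"
  define n where "n = n1 + n2 + n3"
  \<comment> \<open>Chosen so that \<open>d * T + 1 \<le> (d * n + 1) * N\<close>, whose square is
    \<open>N ^ 3\<close> and hence less than \<open>(N + 1) ^ 3\<close>: there are more monomials
    than coefficients to cancel. \<open>T\<close> is the largest degree of a monomial before
    homogenisation, up to rounding \<open>n1\<close>, \<open>n2\<close>, \<open>n3\<close> into
    their sum \<open>n\<close>.\<close>
  define N where "N = (d * n + 1) ^ 2"
  define T where "T = N * n"
  have bound: "c * n3 + b * n2 + a * n1 \<le> T" if "a \<le> N" "b \<le> N" "c \<le> N" for a b c
  proof -
    have "c * n3 \<le> N * n3" "b * n2 \<le> N * n2" "a * n1 \<le> N * n1"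
      using that by simp_all
    then show ?thesis
      unfolding T_def n_def distrib_left by linarith
  qed
  \<comment> \<open>The nesting and the order of subtraction follow the way the relation is taken
    apart: first powers of \<open>f3\<close>, then of \<open>f2\<close>, then of
    \<open>f1\<close>.\<close>
  define m where "m a b c = f3 ^ c * (f2 ^ b * (f1 ^ a * ?l ^ (T - c * n3 - b * n2 - a * n1)))" for a b c
  have l_form: "form d j (?l ^ j)" for j
    using form_power[OF form_pvar[OF k(1)], of j] by simp
  have m: "form d T (m a b c)" if "a \<le> N" "b \<le> N" "c \<le> N" for a b c
  proof -
    have "form d (c * n3 + (b * n2 + (a * n1 + (T - c * n3 - b * n2 - a * n1)))) (m a b c)"
      unfolding m_def by (intro form_mult form_power f1 f2 f3 l_form)
    then show ?thesis
      using bound[OF that] by simp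
  qed
  let ?I = "{..N} \<times> {..N} \<times> {..N}" and ?J = "{..d * T} \<times> {..d * T}"
  have "\<forall>i\<in>?I. \<exists>A. \<forall>u \<theta>. peval (case i of (a, b, c) \<Rightarrow> m a b c) (gamma_vec d u \<theta>) =
      (\<Sum>p\<in>?J. A p * (u ^ fst p * \<theta> ^ snd p))"
    using bidegree_le_form[OF m] unfolding bidegree_le_def by auto
  from bchoice[OF this] obtain A where A: "\<forall>i\<in>?I. \<forall>u \<theta>. peval (case i of (a, b, c) \<Rightarrow> m a b c) (gamma_vec d u \<theta>) =
      (\<Sum>p\<in>?J. A i p * (u ^ fst p * \<theta> ^ snd p))"
    by blast
  have "card ?J < card ?I"
  proof -
    have "N \<ge> 1"
      by (simp add: N_def)
    then have "d * T + 1 \<le> (d * n + 1) * N"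
      by (simp add: T_def algebra_simps)
    then have "(d * T + 1)\<^sup>2 \<le> ((d * n + 1) * N)\<^sup>2"
      by (rule power_mono) simp
    also have "\<dots> = N * N\<^sup>2"
      by (simp only: power_mult_distrib N_def[symmetric])
    also have "\<dots> = N ^ 3"
      by (simp add: power2_eq_square power3_eq_cube)
    also have "\<dots> < (N + 1) ^ 3"
      by (rule power_strict_mono) auto
    also have "(d * T + 1)\<^sup>2 = card ?J"
      by (simp add: card_cartesian_product power2_eq_square)
    also have "(N + 1) ^ 3 = card ?I"
      by (simp add: card_cartesian_product power3_eq_cube algebra_simps)
    finally show ?thesis .
  qed
  moreover have "finite ?J" "finite ?I"
    by auto
  ultimately obtain e where e: "\<exists>i\<in>?I. e i \<noteq> 0" "\<forall>p\<in>?J. (\<Sum>i\<in>?I. e i * A i p) = 0"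
    using underdetermined_system[of ?J ?I A] by blast
  \<comment> \<open>The relation becomes a polynomial in \<open>f3\<close> whose coefficients are
    polynomials in \<open>f2\<close> whose coefficients are polynomials in \<open>f1\<close>: one
    layer for each inclusion of the chain.\<close>
  define g1 where "g1 a b c = const_poly (e (a, b, c)) * ?l ^ (T - c * n3 - b * n2 - a * n1)" for a b c
  define g2 where "g2 b c = (\<Sum>a\<le>N. f1 ^ a * g1 a b c)" for b c
  define g3 where "g3 c = (\<Sum>b\<le>N. f2 ^ b * g2 b c)" for c
  define H where "H = (\<Sum>c\<le>N. f3 ^ c * g3 c)"
  have g1: "form d (T - c * n3 - b * n2 - a * n1) (g1 a b c)" for a b c
    using form_mult[OF form_const l_form] by (simp add: g1_def)
  have g2: "form d (T - c * n3 - b * n2) (g2 b c)" if "b \<le> N" "c \<le> N" for b c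
    unfolding g2_def using bound[OF le_refl that] by (intro form_power_sum[OF f1(1)] g1) simp
  have g3: "form d (T - c * n3) (g3 c)" if "c \<le> N" for c
    unfolding g3_def using bound[OF _ le_refl that, of 0] that
    by (intro form_power_sum[OF f2(1)] g2) simp_all
  have H: "form d T H"
    unfolding H_def using bound[OF _ _ le_refl, of 0 0]
    by (intro form_power_sum[OF f3(1)] g3) simp_all
  have "peval H (gamma_vec d u \<theta>) = 0" for u \<theta>
  proof -
    have "peval H (gamma_vec d u \<theta>) =
        (\<Sum>c\<le>N. \<Sum>b\<le>N. \<Sum>a\<le>N. e (a, b, c) * peval (m a b c) (gamma_vec d u \<theta>))"
      by (simp add: H_def g3_def g2_def g1_def m_def peval_simps sum_distrib_left mult_ac)
    also have "\<dots> = (\<Sum>b\<le>N. \<Sum>c\<le>N. \<Sum>a\<le>N. e (a, b, c) * peval (m a b c) (gamma_vec d u \<theta>))"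
      by (rule sum.swap)
    also have "\<dots> = (\<Sum>b\<le>N. \<Sum>a\<le>N. \<Sum>c\<le>N. e (a, b, c) * peval (m a b c) (gamma_vec d u \<theta>))"
      by (intro sum.cong refl sum.swap)
    also have "\<dots> = (\<Sum>a\<le>N. \<Sum>b\<le>N. \<Sum>c\<le>N. e (a, b, c) * peval (m a b c) (gamma_vec d u \<theta>))"
      by (rule sum.swap)
    also have "\<dots> = (\<Sum>i\<in>?I. e i * peval (case i of (a, b, c) \<Rightarrow> m a b c) (gamma_vec d u \<theta>))"
      by (simp add: sum.cartesian_product case_prod_unfold)
    also have "\<dots> = (\<Sum>i\<in>?I. \<Sum>p\<in>?J. e i * A i p * (u ^ fst p * \<theta> ^ snd p))"
      by (intro sum.cong refl) (simp only: A[rule_format] sum_distrib_left mult.assoc)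
    also have "\<dots> = (\<Sum>p\<in>?J. (\<Sum>i\<in>?I. e i * A i p) * (u ^ fst p * \<theta> ^ snd p))"
      by (subst sum.swap) (simp add: sum_distrib_right)
    also have "\<dots> = 0"
      using e(2) by (intro sum.neutral) auto
    finally show ?thesis .
  qed
  then have H3: "vanishes_on H Z3"
    using par[OF H] by blast
  \<comment> \<open>\<open>(c0, b0, a0)\<close> will be the lexicographically least index with a
    nonzero coefficient, so that in each layer all earlier terms are zero.\<close>
  define c0 where "c0 = (LEAST c. c \<le> N \<and> (\<exists>b\<le>N. \<exists>a\<le>N. e (a, b, c) \<noteq> 0))"
  have "\<exists>c. c \<le> N \<and> (\<exists>b\<le>N. \<exists>a\<le>N. e (a, b, c) \<noteq> 0)"
    using e(1) by auto
  from LeastI_ex[OF this] have c0: "c0 \<le> N" "\<exists>b\<le>N. \<exists>a\<le>N. e (a, b, c0) \<noteq> 0"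
    unfolding c0_def by auto
  have c0_min: "e (a, b, c) = 0" if "c < c0" "a \<le> N" "b \<le> N" for a b c
    using not_less_Least[OF that(1)[unfolded c0_def]] that c0(1) by auto
  define b0 where "b0 = (LEAST b. b \<le> N \<and> (\<exists>a\<le>N. e (a, b, c0) \<noteq> 0))"
  have "\<exists>b. b \<le> N \<and> (\<exists>a\<le>N. e (a, b, c0) \<noteq> 0)"
    using c0 by auto
  from LeastI_ex[OF this] have b0: "b0 \<le> N" "\<exists>a\<le>N. e (a, b0, c0) \<noteq> 0"
    unfolding b0_def by auto
  have b0_min: "e (a, b, c0) = 0" if "b < b0" "a \<le> N" for a b
    using not_less_Least[OF that(1)[unfolded b0_def]] that b0(1) by auto
  define a0 where "a0 = (LEAST a. a \<le> N \<and> e (a, b0, c0) \<noteq> 0)"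
  have "\<exists>a. a \<le> N \<and> e (a, b0, c0) \<noteq> 0"
    using b0 by auto
  from LeastI_ex[OF this] have a0: "a0 \<le> N" "e (a0, b0, c0) \<noteq> 0"
    unfolding a0_def by auto
  have a0_min: "e (a, b0, c0) = 0" if "a < a0" for a
    using not_less_Least[OF that(1)[unfolded a0_def]] that a0(1) by auto
  have zero: "const_poly 0 = 0"
    by (simp add: const_poly_def)
  have "vanishes_on (g3 c0) Z2"
  proof (rule leading_term_vanishes[OF irr(4) _ f3 g3 _ c0(1) _ H3[unfolded H_def]])
    show "g3 c = 0" if "c < c0" for c
      using that by (simp add: g3_def g2_def g1_def c0_min zero)
  qed (use sub bound[OF _ _ le_refl, of 0 0] in auto)
  then have "vanishes_on (g2 b0 c0) Z1"
    unfolding g3_def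
  proof (rule leading_term_vanishes[OF irr(3) _ f2 g2 _ b0(1), rotated -1])
    show "g2 b c0 = 0" if "b < b0" for b
      using that by (simp add: g2_def g1_def b0_min zero)
  qed (use sub c0 bound[OF _ le_refl c0(1), of 0] in auto)
  then have "vanishes_on (g1 a0 b0 c0) Z0"
    unfolding g2_def
  proof (rule leading_term_vanishes[OF irr(2) _ f1 g1 _ a0(1), rotated -1])
    show "g1 a b0 c0 = 0" if "a < a0" for a
      using that by (simp add: g1_def a0_min zero)
  qed (use sub c0 b0 bound[OF le_refl b0(1) c0(1)] in auto)
  \<comment> \<open>What is left at the bottom is the nonzero coefficient times a power of
    \<open>x k\<close>, which is nonzero.\<close>
  then have "peval (g1 a0 b0 c0) x = 0"
    using P x by (auto simp: vanishes_on_def)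
  then show False
    using a0 k by (simp add: g1_def peval_simps)
qed


section \<open>Points of the gamma moment variety\<close>

text \<open>Multiplication by \<open>t - a\<close> removes the exceptional point. This takes the
  place of every passage to the limit below.\<close>

lemma poly_zero_punctured:
  fixes p :: "complex poly"
  assumes "\<And>t. t \<noteq> a \<Longrightarrow> poly p t = 0"
  shows "p = 0"
proof -
  have "poly ([:- a, 1:] * p) t = 0" for t
    using assms[of t] by (cases "t = a") auto
  then have "[:- a, 1:] * p = 0"
    by (metis poly_all_0_iff_0)
  then show ?thesis
    using no_zero_divisors[of "[:- a, 1:]" p] by auto
qed

lemma gamma_vec_0 [simp]: "gamma_vec d u \<theta> 0 = 1"
  by (simp add: gamma_vec_def)

lemma gamma_vec_Suc: "i < d \<Longrightarrow> gamma_vec d u \<theta> (Suc i) = gamma_vec d u \<theta> i * (u + of_nat i * \<theta>)"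
  by (simp add: gamma_vec_def)

lemma gamma_vec_in_vecs: "gamma_vec d u \<theta> \<in> vecs d"
  by (simp add: gamma_vec_def vecs_def)

lemma gamma_moment_point_eq: "gamma_moment_point d k \<theta> = hpoint (gamma_vec d (k * \<theta>) \<theta>)"
proof -
  have "\<theta> ^ i * (\<Prod>j<i. k + of_nat j) = (\<Prod>j<i. k * \<theta> + of_nat j * \<theta>)" for i
    by (induction i) (simp_all add: algebra_simps)
  then show ?thesis
    by (simp only: gamma_moment_point_def gamma_vec_def gamma_moment_def)
qed

lemma gamma_vec_hpoints: "hpoint ` {gamma_vec d u \<theta> |u \<theta>. True} \<subseteq> proj_space d"
  using gamma_vec_in_vecs by (intro hpoint_image_subset) (auto intro!: exI[of _ 0])

text \<open>The substitution \<open>u = k \<theta>\<close> misses the line \<open>\<theta> = 0\<close> except for its origin, which does not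
  affect the closure.\<close>

lemma gamma_moment_variety_eq:
  "gamma_moment_variety d = zariski_closure d (hpoint ` {gamma_vec d u \<theta> |u \<theta>. True})"
proof -
  let ?S = "{gamma_moment_point d k \<theta> |k \<theta>. True}" and ?T = "hpoint ` {gamma_vec d u \<theta> |u \<theta>. True}"
  have ST: "?S \<subseteq> ?T"
    by (auto simp: gamma_moment_point_eq)
  have S: "?S = hpoint ` {gamma_vec d (k * \<theta>) \<theta> |k \<theta>. True}"
    by (auto simp: gamma_moment_point_eq)
  have "vanishes_on f ?T" if f: "form d n f" and fS: "vanishes_on f ?S" for f n
  proof -
    have 0: "peval f (gamma_vec d u \<theta>) = 0" if "\<theta> \<noteq> 0" for u \<theta>
    proof -
      have "gamma_vec d u \<theta> \<in> {gamma_vec d (k * \<theta>) \<theta> |k \<theta>. True}"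
        using that by (intro CollectI exI[of _ "u / \<theta>"] exI[of _ \<theta>]) simp
      moreover have "\<forall>x\<in>{gamma_vec d (k * \<theta>) \<theta> |k \<theta>. True}. peval f x = 0"
        using fS unfolding S vanishes_on_hpoints[OF f] .
      ultimately show ?thesis
        by blast
    qed
    have "peval f (gamma_vec d u \<theta>) = 0" for u \<theta>
    proof -
      \<comment> \<open>For fixed \<open>u\<close> the coordinates are polynomials in \<theta>, so
        vanishing for all nonzero \<theta> extends to \<theta> = 0.\<close>
      have "gamma_vec d u \<theta> = (\<lambda>i. poly (if i \<le> d then \<Prod>j<i. [:u, of_nat j:] else 0) \<theta>)" for \<theta>
        by (auto simp: gamma_vec_def poly_prod mult.commute)
      then obtain p where p: "\<And>\<theta>. peval f (gamma_vec d u \<theta>) = poly p \<theta>"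
        using peval_poly_curve[of f "\<lambda>i. if i \<le> d then \<Prod>j<i. [:u, of_nat j:] else 0"] by auto
      have "p = 0"
        by (rule poly_zero_punctured[of 0]) (use 0 p in metis)
      then show ?thesis
        by (simp add: p)
    qed
    then show ?thesis
      unfolding vanishes_on_hpoints[OF f] by blast
  qed
  then have "vanishes_on f ?S \<longleftrightarrow> vanishes_on f ?T" if "form d n f" for f n
    using that vanishes_on_subset[OF _ ST] by blast
  then show ?thesis
    unfolding gamma_moment_variety_def zariski_closure_altdef[OF gamma_vec_hpoints]
      zariski_closure_altdef[OF order.trans[OF ST gamma_vec_hpoints]]
    by blast
qed

lemma gamma_variety_subset: "gamma_moment_variety d \<subseteq> proj_space d"
  unfolding gamma_moment_variety_eq
  by (intro zariski_closed_subset zariski_closed_closure gamma_vec_hpoints)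

text \<open>Reduces a statement about the whole closure to an identity in two complex
  parameters.\<close>

lemma vanishes_on_gamma_variety:
  assumes "form d n f"
  shows "vanishes_on f (gamma_moment_variety d) \<longleftrightarrow> (\<forall>u \<theta>. peval f (gamma_vec d u \<theta>) = 0)"
proof -
  have "vanishes_on f (gamma_moment_variety d) \<longleftrightarrow> vanishes_on f (hpoint ` {gamma_vec d u \<theta> |u \<theta>. True})"
    unfolding gamma_moment_variety_eq
    using vanishes_on_closure[OF gamma_vec_hpoints assms] vanishes_on_subset[OF _ closure_subset] by blast
  then show ?thesis
    unfolding vanishes_on_hpoints[OF assms] by blast
qed

lemma irreducible_gamma_variety: "irreducible_closed d (gamma_moment_variety d)"
  unfolding gamma_moment_variety_eq
proof (rule irreducible_closure)
  fix a b assume "a \<in> {gamma_vec d u \<theta> |u \<theta>. True}" "b \<in> {gamma_vec d u \<theta> |u \<theta>. True}"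
  then obtain u \<theta> v \<eta> where ab: "a = gamma_vec d u \<theta>" "b = gamma_vec d v \<eta>"
    by blast
  \<comment> \<open>The image of the segment between the two parameter pairs.\<close>
  define \<gamma> where "\<gamma> i = (if i \<le> d then \<Prod>j<i. [:u + of_nat j * \<theta>, v - u + of_nat j * (\<eta> - \<theta>):] else 0)" for i
  have \<gamma>: "(\<lambda>i. poly (\<gamma> i) t) = gamma_vec d (u + t * (v - u)) (\<theta> + t * (\<eta> - \<theta>))" for t
    by (auto simp: fun_eq_iff \<gamma>_def gamma_vec_def poly_prod algebra_simps intro!: prod.cong)
  show "\<exists>\<gamma>. (\<forall>t. (\<lambda>i. poly (\<gamma> i) t) \<in> {gamma_vec d u \<theta> |u \<theta>. True}) \<and>
      (\<lambda>i. poly (\<gamma> i) 0) = a \<and> (\<lambda>i. poly (\<gamma> i) 1) = b"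
    by (rule exI[of _ \<gamma>]) (unfold \<gamma> ab, auto)
next
  show "\<exists>i. x i \<noteq> 0" if "x \<in> {gamma_vec d u \<theta> |u \<theta>. True}" for x
    using that by (intro exI[of _ 0]) auto
qed (use gamma_vec_in_vecs in blast)+

lemma in_gamma_varietyI:
  assumes "x \<in> vecs d" "x k \<noteq> 0"
    and "\<And>n f. form d n f \<Longrightarrow> (\<And>u \<theta>. peval f (gamma_vec d u \<theta>) = 0) \<Longrightarrow> peval f x = 0"
  shows "hpoint x \<in> gamma_moment_variety d"
  unfolding gamma_moment_variety_eq zariski_closure_altdef[OF gamma_vec_hpoints]
proof (intro CollectI conjI allI impI ballI)
  show "hpoint x \<in> proj_space d"
    using assms by (auto simp: proj_space_def)
  fix n f y assume f: "form d n f" "vanishes_on f (hpoint ` {gamma_vec d u \<theta> |u \<theta>. True})"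
    and y: "y \<in> hpoint x"
  have "peval f (gamma_vec d u \<theta>) = 0" for u \<theta>
    using f(2) unfolding vanishes_on_hpoints[OF f(1)] by blast
  then show "peval f y = 0"
    using assms(3)[OF f(1)] peval_hpoint_zero[OF f(1) y] by blast
qed

lemma gamma_vec_in_variety: "hpoint (gamma_vec d u \<theta>) \<in> gamma_moment_variety d"
  by (rule in_gamma_varietyI[of _ _ 0]) (simp_all add: gamma_vec_in_vecs)

section \<open>Limit points of the surface\<close>

definition unit_vec :: "nat \<Rightarrow> nat \<Rightarrow> complex" where
  "unit_vec k = (\<lambda>j. if j = k then 1 else 0)"

text \<open>The line joining the coordinate points \<open>i\<close> and \<open>d\<close>, without
  the point \<open>d\<close> itself, which corresponds to infinite \<open>y\<close>.\<close>

definition line_vec :: "nat \<Rightarrow> nat \<Rightarrow> complex \<Rightarrow> nat \<Rightarrow> complex" where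
  "line_vec d i y = (\<lambda>j. if j = i then 1 else if j = d then y else 0)"

lemma line_vec_in_vecs: "i < d \<Longrightarrow> line_vec d i y \<in> vecs d"
  by (auto simp: line_vec_def vecs_def)

text \<open>The points of the line are limits of the surface for \<open>\<theta> = 1 / \<epsilon>\<close>, \<open>u = (z \<epsilon>\<^sup>d\<^sup>-\<^sup>i - i) / \<epsilon>\<close>
  and \<open>\<epsilon> \<rightarrow> 0\<close>, after rescaling by \<open>\<epsilon>\<^sup>i\<close>.\<close>

lemma line_vec_in_variety:
  assumes i: "i < d"
  shows "hpoint (line_vec d i y) \<in> gamma_moment_variety d"
proof (rule in_gamma_varietyI[of _ _ i])
  \<comment> \<open>\<open>a\<close> and \<open>b\<close> are the values at \<open>t = 0\<close> of
    the products of the \<open>q l\<close> that occur in coordinates \<open>i\<close> and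
    \<open>d\<close> of the curve; no factor with \<open>l = i\<close> occurs, so both are
    nonzero.\<close>
  define a :: complex where "a = (\<Prod>l<i. of_nat l - of_nat i)"
  define b :: complex where "b = (\<Prod>l\<in>{..<d} - {i}. of_nat l - of_nat i)"
  have ab: "a \<noteq> 0" "b \<noteq> 0"
    by (auto simp: a_def b_def)
  \<comment> \<open>In the limit the coordinates \<open>i\<close> and \<open>d\<close> are
    \<open>a\<close> and \<open>z * b\<close>, whose ratio has to be \<open>y\<close>.\<close>
  define z where "z = y * a / b"
  define \<delta> where "\<delta> = monom z (d - i)"
  define q where "q l = \<delta> + [:of_nat l - of_nat i:]" for l
  \<comment> \<open>This is \<open>t ^ i * gamma_vec\<close> with denominators cleared. For
    \<open>j > i\<close> the product contains \<open>q i\<close>, which is just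
    \<open>z * t ^ (d - i)\<close>; extracting it leaves the nonnegative power
    \<open>t ^ (d - j)\<close>.\<close>
  define \<Phi> where "\<Phi> j = (if j \<le> i then monom 1 (i - j) * (\<Prod>l<j. q l)
      else if j \<le> d then monom z (d - j) * (\<Prod>l\<in>{..<j} - {i}. q l) else 0)" for j
  fix n f assume f: "form d n f" "\<And>u \<theta>. peval f (gamma_vec d u \<theta>) = 0"
  obtain p where p: "\<And>t. peval f (\<lambda>j. poly (\<Phi> j) t) = poly p t"
    using peval_poly_curve by blast
  have "poly p t = 0" if t: "t \<noteq> 0" for t
  proof -
    define u where "u = (z * t ^ (d - i) - of_nat i) / t"
    have fac: "u + of_nat l * (1 / t) = poly (q l) t / t" for l
      using t by (simp add: u_def q_def \<delta>_def poly_monom field_simps)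
    have "poly (\<Phi> j) t = t ^ i * gamma_vec d u (1 / t) j" for j
    proof (cases "j \<le> d")
      case True
      then have g: "gamma_vec d u (1 / t) j = (\<Prod>l<j. poly (q l) t) / t ^ j"
        unfolding gamma_vec_def fac by (simp add: prod_dividef)
      show ?thesis
      proof (cases "j \<le> i")
        case True
        then have "t ^ i = t ^ (i - j) * t ^ j"
          by (simp flip: power_add)
        then show ?thesis
          using True t by (simp add: \<Phi>_def g poly_monom poly_prod)
      next
        case False
        have "(\<Prod>l<j. poly (q l) t) = poly (q i) t * (\<Prod>l\<in>{..<j} - {i}. poly (q l) t)"
          using False by (intro prod.remove) auto
        moreover have "poly (q i) t = z * t ^ (d - i)"
          by (simp add: q_def \<delta>_def poly_monom)
        moreover have "t ^ i * t ^ (d - i) = t ^ (d - j) * t ^ j"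
          using i \<open>j \<le> d\<close> by (simp flip: power_add)
        ultimately show ?thesis
          using False \<open>j \<le> d\<close> t by (simp add: \<Phi>_def g poly_monom poly_prod field_simps)
      qed
    qed (use i in \<open>simp add: \<Phi>_def gamma_vec_def\<close>)
    then have "peval f (\<lambda>j. poly (\<Phi> j) t) = (t ^ i) ^ n * peval f (gamma_vec d u (1 / t))"
      using peval_scale[OF f(1)] by simp
    then show ?thesis
      using f(2) p by simp
  qed
  then have "p = 0"
    by (rule poly_zero_punctured)
  \<comment> \<open>Every coordinate up to \<open>d\<close> other than \<open>i\<close> and
    \<open>d\<close> keeps a positive power of \<open>t\<close>.\<close>
  have "poly (\<Phi> j) 0 = a * line_vec d i y j" for j
  proof -
    have q0: "poly (q l) 0 = of_nat l - of_nat i" for l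
      using i by (simp add: q_def \<delta>_def poly_monom)
    consider "j < i" | "j = i" | "i < j" "j < d" | "j = d" | "d < j"
      by linarith
    then show ?thesis
      using i ab by cases (simp_all add: \<Phi>_def line_vec_def poly_monom poly_prod q0 a_def[symmetric]
        b_def[symmetric], simp add: z_def)
  qed
  then have "a ^ n * peval f (line_vec d i y) = 0"
    using p[of 0] \<open>p = 0\<close> peval_scale[OF f(1)] by simp
  then show "peval f (line_vec d i y) = 0"
    using ab by simp
qed (use i line_vec_in_vecs in \<open>auto simp: line_vec_def\<close>)

lemma unit_vec_last_in_variety:
  assumes "d \<ge> 1"
  shows "hpoint (unit_vec d) \<in> gamma_moment_variety d"
proof (rule in_gamma_varietyI[of _ _ d])
  fix n f assume f: "form d n f" "\<And>u \<theta>. peval f (gamma_vec d u \<theta>) = 0"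
  \<comment> \<open>The line with \<open>i = 0\<close> at \<open>y = 1 / t\<close>, rescaled by
    \<open>t\<close>; the vertex is reached at \<open>t = 0\<close>.\<close>
  define \<Phi> :: "nat \<Rightarrow> complex poly" where "\<Phi> j = (if j = 0 then [:0, 1:] else if j = d then 1 else 0)" for j
  obtain p where p: "\<And>t. peval f (\<lambda>j. poly (\<Phi> j) t) = poly p t"
    using peval_poly_curve by blast
  have "poly p t = 0" if "t \<noteq> 0" for t
  proof -
    have "(\<lambda>j. poly (\<Phi> j) t) = (\<lambda>j. t * line_vec d 0 (1 / t) j)"
      using that by (auto simp: \<Phi>_def line_vec_def)
    moreover have "peval f (line_vec d 0 (1 / t)) = 0"
      using line_vec_in_variety[of 0 d "1 / t"] vanishes_on_gamma_variety[OF f(1)] f(2) assms hpoint_self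
      unfolding vanishes_on_def by fastforce
    ultimately show ?thesis
      using p[of t] peval_scale[OF f(1)] by simp
  qed
  then have "p = 0"
    by (rule poly_zero_punctured)
  moreover have "(\<lambda>j. poly (\<Phi> j) 0) = unit_vec d"
    using assms by (auto simp: \<Phi>_def unit_vec_def)
  ultimately show "peval f (unit_vec d) = 0"
    using p[of 0] by simp
qed (auto simp: unit_vec_def vecs_def)

text \<open>The maximal minors of the matrix with rows \<open>m\<^sub>j\<close>, \<open>j m\<^sub>j\<close>, \<open>m\<^sub>j\<^sub>+\<^sub>1\<close> for \<open>j < d\<close>, which drops rank
  because \<open>m\<^sub>j\<^sub>+\<^sub>1 = (u + j \<theta>) m\<^sub>j\<close>.\<close>

definition minor :: "nat \<Rightarrow> nat \<Rightarrow> nat \<Rightarrow> mpoly" where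
  "minor p q r =
     const_poly (of_nat r - of_nat q) * (pvar (Suc p) * pvar q * pvar r) +
     const_poly (of_nat p - of_nat r) * (pvar (Suc q) * pvar p * pvar r) +
     const_poly (of_nat q - of_nat p) * (pvar (Suc r) * pvar p * pvar q)"

lemma form_minor:
  assumes "p < d" "q < d" "r < d"
  shows "form d 3 (minor p q r)"
proof -
  have "form d (0 + (1 + 1 + 1)) (minor p q r)"
    unfolding minor_def using assms by (intro form_add form_mult form_const form_pvar) auto
  then show ?thesis
    by (simp add: numeral_3_eq_3)
qed

lemma peval_minor: "peval (minor p q r) x =
    (of_nat r - of_nat q) * (x (Suc p) * x q * x r) +
    (of_nat p - of_nat r) * (x (Suc q) * x p * x r) +
    (of_nat q - of_nat p) * (x (Suc r) * x p * x q)"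
  by (simp add: minor_def peval_simps)

text \<open>By the recursion the minor is \<open>m\<^sub>p m\<^sub>q m\<^sub>r\<close> times
  \<open>(r - q) (u + p \<theta>) + (p - r) (u + q \<theta>) + (q - p) (u + r \<theta>)\<close>,
  which is zero.\<close>

lemma minor_vanishes:
  assumes "p < d" "q < d" "r < d"
  shows "vanishes_on (minor p q r) (gamma_moment_variety d)"
  unfolding vanishes_on_gamma_variety[OF form_minor[OF assms]] peval_minor
  using assms by (auto simp: gamma_vec_Suc algebra_simps)

lemma gamma_variety_minors:
  assumes "P \<in> gamma_moment_variety d" "x \<in> P" "p < d" "q < d" "r < d"
  shows "(of_nat r - of_nat q) * (x (Suc p) * x q * x r) +
    (of_nat p - of_nat r) * (x (Suc q) * x p * x r) +
    (of_nat q - of_nat p) * (x (Suc r) * x p * x q) = 0"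
  using assms minor_vanishes[of p d q r] by (auto simp: vanishes_on_def peval_minor)

text \<open>If coordinates 0 and 1 are nonzero, the minors \<open>0 1 r\<close> determine the others
  recursively. Otherwise let \<open>p\<close> be the first nonzero coordinate: the minors
  \<open>p - 1, p, q\<close>, or for \<open>p = 0\<close> inductively \<open>0, q, q + 1\<close>,
  kill everything strictly between \<open>p\<close> and \<open>d\<close>. The surface case may
  require \<open>u \<noteq> 0\<close>, since \<open>u = 0\<close> gives only the point
  \<open>y = 0\<close> of the line with \<open>i = 0\<close>.\<close>

lemma gamma_variety_cases:
  assumes d: "d \<ge> 3" and P: "P \<in> gamma_moment_variety d"
  obtains (surface) u \<theta> where "P = hpoint (gamma_vec d u \<theta>)" "u \<noteq> 0"
    | (line) i y where "P = hpoint (line_vec d i y)" "i < d"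
    | (vertex) "P = hpoint (unit_vec d)"
proof -
  have Ps: "P \<in> proj_space d"
    using P gamma_variety_subset by blast
  then obtain x where x: "x \<in> P"
    using hpoint_self by (auto simp: proj_space_def)
  note xP = proj_spaceE[OF Ps x]
  note minors = gamma_variety_minors[OF P x]
  show thesis
  proof (cases "x 0 \<noteq> 0 \<and> x 1 \<noteq> 0")
    case True
    define u where "u = x 1 / x 0"
    \<comment> \<open>Inverts the parametrisation: the first two ratios of consecutive coordinates
      are \<open>u\<close> and \<open>u + \<theta>\<close>.\<close>
    define \<theta> where "\<theta> = x 2 / x 1 - u"
    have step: "x (Suc r) = x r * (u + of_nat r * \<theta>)" if r: "r < d" for r
    proof (cases "r \<ge> 2")
      case True
      have "(of_nat r - 1) * (x 1 * x 1 * x r) - of_nat r * (x 2 * x 0 * x r) + x (Suc r) * x 0 * x 1 = 0"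
        using minors[of 0 1 r] r d by (simp add: numeral_2_eq_2 algebra_simps)
      then show ?thesis
        using \<open>x 0 \<noteq> 0 \<and> x 1 \<noteq> 0\<close> by (simp add: u_def \<theta>_def field_simps)
    next
      case False
      then consider "r = 0" | "r = 1" by linarith
      then show ?thesis
        using True by cases (simp_all add: u_def \<theta>_def numeral_2_eq_2)
    qed
    have le: "x i = x 0 * gamma_vec d u \<theta> i" if "i \<le> d" for i
      using that
    proof (induction i)
      case (Suc i)
      then have "i < d" "x i = x 0 * gamma_vec d u \<theta> i"
        by auto
      then show ?case
        using step[of i] gamma_vec_Suc[of i d u \<theta>] by (simp only: mult.assoc)
    qed simp
    have "x = (\<lambda>i. x 0 * gamma_vec d u \<theta> i)"
    proof
      fix i show "x i = x 0 * gamma_vec d u \<theta> i"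
        using le[of i] xP(2) by (cases "i \<le> d") (simp_all add: vecs_def gamma_vec_def)
    qed
    then have "P = hpoint (gamma_vec d u \<theta>)"
      using hpoint_scale[of "x 0" "gamma_vec d u \<theta>"] True xP(1) by metis
    then show thesis
      using surface True by (simp add: u_def)
  next
    case False
    define p where "p = (LEAST p. x p \<noteq> 0)"
    have p: "x p \<noteq> 0" and below: "\<And>q. q < p \<Longrightarrow> x q = 0"
      using LeastI_ex[of "\<lambda>p. x p \<noteq> 0"] not_less_Least[of _ "\<lambda>p. x p \<noteq> 0"] xP(3)
      unfolding p_def by blast+
    have "p \<le> d"
      using p xP(2) by (auto simp: vecs_def not_le[symmetric])
    have above: "x q = 0" if q: "p < q" "q < d" for q
    proof (cases p)
      case (Suc k)
      have "x k = 0"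
        using below Suc by simp
      then have "(of_nat q - of_nat p) * (x p * x p * x q) = 0"
        using minors[of k p q] q Suc by simp
      moreover have "of_nat q \<noteq> (of_nat p :: complex)"
        using q by simp
      ultimately show ?thesis
        using p by simp
    next
      case 0
      have "x q = 0" if "q \<ge> 1" "q < d" for q
        using that
      proof (induction q rule: dec_induct)
        case base
        then show ?case
          using False p 0 by auto
      next
        case (step q)
        then have "x q = 0" by simp
        then have "of_nat (Suc q) * (x (Suc q) * x 0 * x (Suc q)) = 0"
          using minors[of 0 q "Suc q"] step by (simp del: of_nat_Suc)
        then show ?case
          using p 0 by (simp del: of_nat_Suc)
      qed
      then show ?thesis
        using q 0 by simp
    qed
    show thesis
    proof (cases "p = d")
      case True
      have "x = (\<lambda>i. x d * unit_vec d i)"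
        using below True xP(2) by (auto simp: fun_eq_iff unit_vec_def vecs_def) (metis linorder_neqE_nat)
      then have "P = hpoint (unit_vec d)"
        using hpoint_scale[of "x d" "unit_vec d"] p True xP(1) by metis
      then show thesis
        by (rule vertex)
    next
      case False
      have "x j = x p * line_vec d p (x d / x p) j" for j
        using p False below[of j] above[of j] xP(2) by (cases j p rule: linorder_cases)
          (auto simp: line_vec_def vecs_def, metis linorder_neqE_nat)
      then have "x = (\<lambda>i. x p * line_vec d p (x d / x p) i)"
        by blast
      then have "P = hpoint (line_vec d p (x d / x p))"
        using hpoint_scale[of "x p" "line_vec d p (x d / x p)"] p xP(1) by metis
      then show thesis
        using line False \<open>p \<le> d\<close> by simp
    qed
  qed
qed


section \<open>Dimension and tangent spaces\<close>

lemma local_dim_le_2: "local_dim d (gamma_moment_variety d) P \<le> 2"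
  unfolding local_dim_def
proof (rule Sup_least)
  fix e assume "e \<in> {enat n |n. \<exists>Z :: nat \<Rightarrow> ppoint set.
      (\<forall>i\<le>n. irreducible_closed d (Z i) \<and> P \<in> Z i \<and> Z i \<subseteq> gamma_moment_variety d) \<and> (\<forall>i<n. Z i \<subset> Z (Suc i))}"
  then obtain n and Z :: "nat \<Rightarrow> ppoint set" where e: "e = enat n"
    and Z: "\<And>i. i \<le> n \<Longrightarrow> irreducible_closed d (Z i)" "\<And>i. i \<le> n \<Longrightarrow> Z i \<subseteq> gamma_moment_variety d"
      "\<And>i. i < n \<Longrightarrow> Z i \<subset> Z (Suc i)"
    by blast
  have "n \<le> 2"
  proof (rule ccontr)
    assume "\<not> n \<le> 2"
    then have n: "3 \<le> n" by simp
    have "vanishes_on f (Z 3)" if "form d m f" "\<And>u \<theta>. peval f (gamma_vec d u \<theta>) = 0" for m f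
      using vanishes_on_gamma_variety[OF that(1)] that(2) Z(2)[OF n] vanishes_on_subset by blast
    then show False
      using parametrised_surface_chain[of d "Z 0" "Z 1" "Z 2" "Z 3"] Z(1) Z(3)[of 0] Z(3)[of 1] Z(3)[of 2] n
      by (simp add: numeral_2_eq_2 numeral_3_eq_3)
  qed
  then show "e \<le> 2"
    using e by (simp add: numeral_eq_enat)
qed

section \<open>Curves that show the local dimension to be at least 2\<close>

lemma local_dim_ge_2:
  assumes x: "hpoint x \<in> C" "x \<in> vecs d" "\<exists>i. x i \<noteq> 0"
    and C: "irreducible_closed d C" "C \<subset> gamma_moment_variety d" "C \<noteq> {hpoint x}"
  shows "2 \<le> local_dim d (gamma_moment_variety d) (hpoint x)"
proof -
  define Z where "Z i = (if i = 0 then {hpoint x} else if i = 1 then C else gamma_moment_variety d)" for i :: nat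
  have "irreducible_closed d (Z i) \<and> hpoint x \<in> Z i \<and> Z i \<subseteq> gamma_moment_variety d" for i
    using x C irreducible_point[OF x(2,3)] irreducible_gamma_variety[of d] by (auto simp: Z_def)
  moreover have "\<forall>i<2. Z i \<subset> Z (Suc i)"
    using x(1) C by (auto simp: Z_def less_Suc_eq numeral_2_eq_2)
  ultimately have "enat 2 \<le> local_dim d (gamma_moment_variety d) (hpoint x)"
    unfolding local_dim_def by (intro Sup_upper) blast
  then show ?thesis
    by (simp add: numeral_eq_enat)
qed

lemma vanishes_on_imp_psubset: "vanishes_on f A \<Longrightarrow> \<not> vanishes_on f B \<Longrightarrow> A \<subseteq> B \<Longrightarrow> A \<subset> B"
  by auto

lemma gamma_vec_local_dim:
  assumes d: "d \<ge> 2"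
  shows "2 \<le> local_dim d (gamma_moment_variety d) (hpoint (gamma_vec d u \<theta>))"
proof -
  let ?X = "{gamma_vec d v \<theta> |v. True}"
  let ?C = "zariski_closure d (hpoint ` ?X)"
  let ?M = "gamma_moment_variety d"
  have d1: "Suc 0 < d"
    using d by simp
  have sub: "hpoint ` ?X \<subseteq> proj_space d"
    using gamma_vec_hpoints by blast
  have nz: "\<exists>i. x i \<noteq> 0" if "x \<in> ?X" for x
    using that by (intro exI[of _ 0]) auto
  have irr: "irreducible_closed d ?C"
  proof (rule irreducible_closure[OF _ nz])
    fix a b assume "a \<in> ?X" "b \<in> ?X"
    then obtain v w where ab: "a = gamma_vec d v \<theta>" "b = gamma_vec d w \<theta>"
      by blast
    define \<gamma> where "\<gamma> i = (if i \<le> d then \<Prod>j<i. [:v + of_nat j * \<theta>, w - v:] else 0)" for i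
    have \<gamma>: "(\<lambda>i. poly (\<gamma> i) t) = gamma_vec d (v + t * (w - v)) \<theta>" for t
      by (auto simp: fun_eq_iff \<gamma>_def gamma_vec_def poly_prod algebra_simps intro!: prod.cong)
    show "\<exists>\<gamma>. (\<forall>t. (\<lambda>i. poly (\<gamma> i) t) \<in> ?X) \<and> (\<lambda>i. poly (\<gamma> i) 0) = a \<and> (\<lambda>i. poly (\<gamma> i) 1) = b"
      by (rule exI[of _ \<gamma>]) (unfold \<gamma> ab, auto)
  qed (use gamma_vec_in_vecs in blast)+
  \<comment> \<open>The equation saying that the second ratio of coordinates exceeds the first by
    \<theta>. At parameters \<open>v\<close>, \<eta> it takes the value
    \<open>v * (\<eta> - \<theta>)\<close>, so it holds on the curve of constant \<theta> but not on
    the surface.\<close>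
  let ?f = "pvar 0 * pvar 2 + const_poly (-1) * (pvar 1 * pvar 1) + const_poly (- \<theta>) * (pvar 1 * pvar 0)"
  have f: "form d 2 ?f"
  proof -
    have pv: "form d 1 (pvar 0)" "form d 1 (pvar 1)" "form d 1 (pvar 2)"
      using d by (simp_all add: form_pvar del: One_nat_def)
    have "form d 2 (pvar 0 * pvar 2)"
      using form_mult[OF pv(1) pv(3)] by (simp add: numeral_2_eq_2)
    moreover have "form d 2 (const_poly (-1) * (pvar 1 * pvar 1))"
      using form_mult[OF form_const form_mult[OF pv(2) pv(2)]] by (simp add: numeral_2_eq_2)
    moreover have "form d 2 (const_poly (- \<theta>) * (pvar 1 * pvar 0))"
      using form_mult[OF form_const form_mult[OF pv(2) pv(1)]] by (simp add: numeral_2_eq_2)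
    ultimately show ?thesis
      by (intro form_add)
  qed
  have ev: "peval ?f (gamma_vec d v \<eta>) = v * (\<eta> - \<theta>)" for v \<eta>
    using d1 by (simp add: peval_simps gamma_vec_Suc numeral_2_eq_2 algebra_simps)
  have "vanishes_on ?f ?C"
    by (rule vanishes_on_closure[OF sub f]) (unfold vanishes_on_hpoints[OF f], safe, unfold ev, simp)
  moreover have "peval ?f (gamma_vec d 1 (\<theta> + 1)) \<noteq> 0"
    unfolding ev by simp
  then have "\<not> vanishes_on ?f ?M"
    unfolding vanishes_on_gamma_variety[OF f] by blast
  moreover have "?C \<subseteq> ?M"
    unfolding gamma_moment_variety_eq zariski_closure_def by (rule hull_mono) blast
  ultimately have CM: "?C \<subset> ?M"
    by (rule vanishes_on_imp_psubset)
  have inC: "hpoint (gamma_vec d v \<theta>) \<in> ?C" for v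
    by (rule subsetD[OF closure_subset]) blast
  have "hpoint (gamma_vec d (u + 1) \<theta>) \<noteq> hpoint (gamma_vec d u \<theta>)"
  proof
    assume "hpoint (gamma_vec d (u + 1) \<theta>) = hpoint (gamma_vec d u \<theta>)"
    then have "gamma_vec d (u + 1) \<theta> \<in> hpoint (gamma_vec d u \<theta>)"
      using hpoint_self by metis
    then obtain c where c: "\<And>i. gamma_vec d (u + 1) \<theta> i = c * gamma_vec d u \<theta> i"
      unfolding hpoint_def by auto metis
    have "c = 1"
      using c[of 0] by simp
    with c[of "Suc 0"] show False
      using d1 by (simp add: gamma_vec_Suc)
  qed
  then have "?C \<noteq> {hpoint (gamma_vec d u \<theta>)}"
    using inC[of "u + 1"] by blast
  then show ?thesis
    using inC gamma_vec_in_vecs irr CM by (intro local_dim_ge_2) (auto intro!: exI[of _ 0])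
qed

lemma line_vec_local_dim:
  assumes d: "d \<ge> 3" and i: "i < d"
  shows "2 \<le> local_dim d (gamma_moment_variety d) (hpoint (line_vec d i y))"
proof -
  let ?X = "{line_vec d i z |z. True}"
  let ?C = "zariski_closure d (hpoint ` ?X)"
  let ?M = "gamma_moment_variety d"
  have vecs: "?X \<subseteq> vecs d"
    using line_vec_in_vecs[OF i] by blast
  have nz: "\<exists>i. x i \<noteq> 0" if "x \<in> ?X" for x
    using that by (intro exI[of _ i]) (auto simp: line_vec_def)
  have sub: "hpoint ` ?X \<subseteq> proj_space d"
    by (rule hpoint_image_subset[OF vecs nz])
  have irr: "irreducible_closed d ?C"
  proof (rule irreducible_closure[OF vecs nz])
    fix a b assume "a \<in> ?X" "b \<in> ?X"
    then obtain v w where ab: "a = line_vec d i v" "b = line_vec d i w"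
      by blast
    define \<gamma> :: "nat \<Rightarrow> complex poly" where "\<gamma> j = (if j = i then 1 else if j = d then [:v, w - v:] else 0)" for j
    have \<gamma>: "(\<lambda>j. poly (\<gamma> j) t) = line_vec d i (v + t * (w - v))" for t
      by (auto simp: fun_eq_iff \<gamma>_def line_vec_def)
    show "\<exists>\<gamma>. (\<forall>t. (\<lambda>j. poly (\<gamma> j) t) \<in> ?X) \<and> (\<lambda>j. poly (\<gamma> j) 0) = a \<and> (\<lambda>j. poly (\<gamma> j) 1) = b"
      by (rule exI[of _ \<gamma>]) (unfold \<gamma> ab, auto)
  qed blast+
  \<comment> \<open>A coordinate other than \<open>i\<close> and \<open>d\<close>: it is zero on the
    line but not at \<open>gamma_vec d 1 0\<close>, all of whose coordinates up to \<open>d\<close>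
    are 1.\<close>
  define k :: nat where "k = (if i = 0 then 1 else 0)"
  have k: "k \<noteq> i" "k < d"
    using d by (auto simp: k_def)
  have f: "form d 1 (pvar k)"
    using k by (intro form_pvar) simp
  have "vanishes_on (pvar k) ?C"
    by (rule vanishes_on_closure[OF sub f])
      (unfold vanishes_on_hpoints[OF f], use k in \<open>auto simp: peval_pvar line_vec_def\<close>)
  moreover have "peval (pvar k) (gamma_vec d 1 0) \<noteq> 0"
    using d by (simp add: peval_pvar k_def gamma_vec_def)
  then have "\<not> vanishes_on (pvar k) ?M"
    unfolding vanishes_on_gamma_variety[OF f] by blast
  moreover have "?C \<subseteq> ?M"
  proof (rule closure_minimal)
    show "hpoint ` ?X \<subseteq> ?M"
      using line_vec_in_variety[OF i] by blast
    show "zariski_closed d ?M"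
      using irreducible_gamma_variety by (simp add: irreducible_closed_def)
  qed
  ultimately have CM: "?C \<subset> ?M"
    by (rule vanishes_on_imp_psubset)
  have inC: "hpoint (line_vec d i z) \<in> ?C" for z
    by (rule subsetD[OF closure_subset]) blast
  have "hpoint (line_vec d i (y + 1)) \<noteq> hpoint (line_vec d i y)"
  proof
    assume "hpoint (line_vec d i (y + 1)) = hpoint (line_vec d i y)"
    then have "line_vec d i (y + 1) \<in> hpoint (line_vec d i y)"
      using hpoint_self by metis
    then obtain c where c: "\<And>j. line_vec d i (y + 1) j = c * line_vec d i y j"
      unfolding hpoint_def by auto metis
    have "c = 1"
      using c[of i] by (simp add: line_vec_def)
    with c[of d] show False
      using i by (simp add: line_vec_def)
  qed
  then have "?C \<noteq> {hpoint (line_vec d i y)}"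
    using inC[of "y + 1"] by blast
  then show ?thesis
    using inC line_vec_in_vecs[OF i] irr CM
    by (intro local_dim_ge_2) (auto intro!: exI[of _ i] simp: line_vec_def)
qed

section \<open>Upper bounds for tangent spaces\<close>

text \<open>Obtained from uniqueness of the derivative along the straight line from \<open>x\<close>
  in direction \<open>v\<close>, without expanding \<open>pdiff\<close>.\<close>

lemma directional_minor:
  assumes "p < d" "q < d" "r < d"
  shows "directional d (minor p q r) x v =
    (of_nat r - of_nat q) * (v (Suc p) * x q * x r + x (Suc p) * v q * x r + x (Suc p) * x q * v r) +
    (of_nat p - of_nat r) * (v (Suc q) * x p * x r + x (Suc q) * v p * x r + x (Suc q) * x p * v r) +
    (of_nat q - of_nat p) * (v (Suc r) * x p * x q + x (Suc r) * v p * x q + x (Suc r) * x p * v q)"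
  (is "_ = ?rhs")
proof -
  let ?\<gamma> = "\<lambda>t i. x i + t * v i"
  have "((\<lambda>t. peval (minor p q r) (?\<gamma> t)) has_field_derivative directional d (minor p q r) (?\<gamma> 0) v) (at 0)"
    using form_minor[OF assms] by (intro peval_has_derivative) (auto simp: form_def intro!: derivative_eq_intros)
  moreover have "((\<lambda>t. peval (minor p q r) (?\<gamma> t)) has_field_derivative ?rhs) (at 0)"
    unfolding peval_minor by (auto intro!: derivative_eq_intros simp: algebra_simps)
  ultimately show ?thesis
    using DERIV_unique by fastforce
qed

lemma directional_add: "directional d f x (v + w) = directional d f x v + directional d f x w"
  by (simp add: directional_def distrib_left sum.distrib)

lemma directional_scale: "directional d f x (vec_scale c v) = c * directional d f x v"
  by (simp add: directional_def vec_scale_def sum_distrib_left mult_ac)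

lemma subspace_cone_tangent_space: "vec.subspace (cone_tangent_space d X P)"
proof (rule vec.subspaceI)
  have eq: "cone_tangent_space d X P =
      {v \<in> vecs d. \<forall>f\<in>vanishing_ideal d X. \<forall>x\<in>P. directional d f x v = 0}"
    by (simp add: cone_tangent_space_def directional_def)
  show "0 \<in> cone_tangent_space d X P"
    by (simp add: eq vecs_def directional_def)
  show "v + w \<in> cone_tangent_space d X P"
    if "v \<in> cone_tangent_space d X P" "w \<in> cone_tangent_space d X P" for v w
    using that by (auto simp: eq vecs_def directional_add)
  show "vec_scale c v \<in> cone_tangent_space d X P" if "v \<in> cone_tangent_space d X P" for c v
    using that unfolding eq by (auto simp: vecs_def directional_scale) (simp add: vec_scale_def)
qed

text \<open>The common kernel of the differentials of the minors contains the tangent space of the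
  cone. If three coordinates determine its vectors, that space has dimension at most 3, and
  \<open>tangent_dim\<close> subtracts the radial direction.\<close>

lemma tangent_dim_le_2:
  assumes I: "finite I" "card I \<le> 3"
    and inj: "\<And>v. v \<in> vecs d \<Longrightarrow>
      (\<And>p q r. p < d \<Longrightarrow> q < d \<Longrightarrow> r < d \<Longrightarrow> directional d (minor p q r) x v = 0) \<Longrightarrow>
      (\<And>i. i \<in> I \<Longrightarrow> v i = 0) \<Longrightarrow> v = 0"
  shows "tangent_dim d (gamma_moment_variety d) (hpoint x) \<le> 2"
proof -
  have "vec.dim (cone_tangent_space d (gamma_moment_variety d) (hpoint x)) \<le> card I"
  proof (rule vec_dim_le[OF subspace_cone_tangent_space I(1)])
    fix v assume v: "v \<in> cone_tangent_space d (gamma_moment_variety d) (hpoint x)"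
      and vI: "\<And>i. i \<in> I \<Longrightarrow> v i = 0"
    have "directional d (minor p q r) x v = 0" if "p < d" "q < d" "r < d" for p q r
      using v form_in_vanishing_ideal[OF form_minor[OF that] minor_vanishes[OF that]] hpoint_self
      unfolding cone_tangent_space_def directional_def by blast
    with inj v vI show "v = 0"
      by (auto simp: cone_tangent_space_def)
  qed
  then show ?thesis
    using I(2) by (simp add: tangent_dim_def)
qed

text \<open>Once \<open>v\<close> vanishes in coordinates 0, 1, 2 and \<open>r\<close>, the
  differential of the minor \<open>0 1 r\<close> reduces to \<open>u * v (Suc r)\<close>, so
  \<open>u \<noteq> 0\<close> propagates the zeros upwards.\<close>

lemma gamma_vec_tangent_dim:
  assumes d: "d \<ge> 3" and u: "u \<noteq> 0"
  shows "tangent_dim d (gamma_moment_variety d) (hpoint (gamma_vec d u \<theta>)) \<le> 2"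
proof (rule tangent_dim_le_2[of "{0, 1, 2}"])
  fix v assume v: "v \<in> vecs d" and v012: "\<And>i. i \<in> {0, 1, 2} \<Longrightarrow> v i = 0"
    and dir: "\<And>p q r. p < d \<Longrightarrow> q < d \<Longrightarrow> r < d \<Longrightarrow> directional d (minor p q r) (gamma_vec d u \<theta>) v = 0"
  have "v i = 0" if "i \<ge> 2" "i \<le> d" for i
    using that
  proof (induction i rule: dec_induct)
    case base
    then show ?case using v012 by simp
  next
    case (step r)
    then have "directional d (minor 0 1 r) (gamma_vec d u \<theta>) v = u * v (Suc r)"
      using d v012 by (subst directional_minor) (auto simp: gamma_vec_Suc numeral_2_eq_2)
    then show ?case
      using dir[of 0 1 r] step d u by auto
  qed
  then have "v i = 0" for i
    using v v012 by (cases "i \<le> d"; cases "i \<ge> 2") (auto simp: vecs_def not_le less_2_cases_iff)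
  then show "v = 0"
    by (simp add: fun_eq_iff)
qed (simp_all add: card_insert_if)

lemma line_vec_tangent_dim:
  assumes d: "d \<ge> 3" and i: "i < d" and y: "i = 0 \<Longrightarrow> y \<noteq> 0"
  shows "tangent_dim d (gamma_moment_variety d) (hpoint (line_vec d i y)) \<le> 2"
proof (cases i)
  case 0
  let ?x = "line_vec d 0 y"
  have "tangent_dim d (gamma_moment_variety d) (hpoint ?x) \<le> 2"
  \<comment> \<open>The minor with indices \<open>0\<close>, \<open>j\<close>, \<open>d - 1\<close>
    involves coordinate \<open>d\<close>, whose value is \<open>y\<close>; its differential reduces
    to \<open>j * y * v j\<close>. This is the step that fails at \<open>y = 0\<close>.\<close>
  proof (rule tangent_dim_le_2[of "{0, d - 1, d}"])
    fix v assume v: "v \<in> vecs d" and vI: "\<And>j. j \<in> {0, d - 1, d} \<Longrightarrow> v j = 0"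
      and dir: "\<And>p q r. p < d \<Longrightarrow> q < d \<Longrightarrow> r < d \<Longrightarrow> directional d (minor p q r) ?x v = 0"
    have mid: "v j = 0" if j: "0 < j" "j < d - 1" for j
    proof -
      have "directional d (minor 0 j (d - 1)) ?x v = of_nat j * (y * v j)"
        using d j vI by (subst directional_minor) (auto simp: line_vec_def)
      then show ?thesis
        using dir[of 0 j "d - 1"] j y 0 by auto
    qed
    have "v j = 0" for j
    proof -
      consider "j \<in> {0, d - 1, d}" | "0 < j" "j < d - 1" | "j > d"
        by force
      then show ?thesis
        by cases (use v vI mid in \<open>simp_all add: vecs_def\<close>)
    qed
    then show "v = 0"
      by (simp add: fun_eq_iff)
  qed (simp_all add: card_insert_if)
  then show ?thesis
    using 0 by simp
next
  case (Suc k)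
  let ?x = "line_vec d (Suc k) y"
  have "tangent_dim d (gamma_moment_variety d) (hpoint ?x) \<le> 2"
  \<comment> \<open>In the minor \<open>k, Suc k, j\<close> coordinate \<open>Suc k\<close> of the
    point occurs squared, so the coefficient of \<open>v j\<close> is a nonzero integer whatever
    \<open>y\<close> is.\<close>
  proof (rule tangent_dim_le_2[of "{k, Suc k, d}"])
    fix v assume v: "v \<in> vecs d" and vI: "\<And>j. j \<in> {k, Suc k, d} \<Longrightarrow> v j = 0"
      and dir: "\<And>p q r. p < d \<Longrightarrow> q < d \<Longrightarrow> r < d \<Longrightarrow> directional d (minor p q r) ?x v = 0"
    have "v j = 0" if j: "j < d" for j
    proof (cases "j \<in> {k, Suc k}")
      case False
      have "?x (Suc k) = 1" "?x k = 0" "?x j = 0" "v k = 0" "v (Suc k) = 0"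
        using False i j vI Suc by (simp_all add: line_vec_def)
      then have "directional d (minor k (Suc k) j) ?x v = (of_nat j - of_nat (Suc k)) * v j"
        using i j Suc by (simp add: directional_minor del: of_nat_Suc)
      moreover have "of_nat j - of_nat (Suc k) \<noteq> (0 :: complex)"
        using False by (simp del: of_nat_Suc)
      ultimately show ?thesis
        using dir[of k "Suc k" j] j i Suc by (simp del: of_nat_Suc)
    qed (use vI in auto)
    then have "v j = 0" for j
      using v vI by (cases j d rule: linorder_cases) (auto simp: vecs_def)
    then show "v = 0"
      by (simp add: fun_eq_iff)
  qed (simp_all add: card_insert_if)
  then show ?thesis
    using Suc by simp
qed

section \<open>Lower bounds for tangent spaces\<close>

text \<open>The velocity of a curve in the affine cone is a tangent vector: each element of the
  ideal is constantly zero along the curve.\<close>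

lemma directional_curve_eq_0:
  assumes f: "f \<in> vanishing_ideal d X"
    and \<gamma>: "\<And>i. i \<le> d \<Longrightarrow> ((\<lambda>z. \<gamma> z i) has_field_derivative \<gamma>' i) (at a)" "\<And>z. hpoint (\<gamma> z) \<in> X"
  shows "directional d f (\<gamma> a) \<gamma>' = 0"
proof -
  have "peval f (\<gamma> z) = 0" for z
    using vanishing_idealD(2)[OF f] \<gamma>(2)[of z] hpoint_self by (auto simp: vanishes_on_def)
  then have "((\<lambda>z. peval f (\<gamma> z)) has_field_derivative 0) (at a)"
    by simp
  moreover have "((\<lambda>z. peval f (\<gamma> z)) has_field_derivative directional d f (\<gamma> a) \<gamma>') (at a)"
    by (rule peval_has_derivative[OF vanishing_idealD(1)[OF f] \<gamma>(1)])
  ultimately show ?thesis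
    by (rule DERIV_unique[symmetric])
qed

text \<open>The curve \<open>exp z * x\<close> stays on the ray of \<open>x\<close>, never reaches
  the zero vector and has velocity \<open>x\<close> at 0. This covers inhomogeneous members of the
  ideal as well.\<close>

lemma directional_euler:
  assumes f: "f \<in> vanishing_ideal d X" and x: "hpoint x \<in> X"
  shows "directional d f x x = 0"
proof -
  have "hpoint (\<lambda>i. exp z * x i) \<in> X" for z
    using hpoint_scale[of "exp z" x] x by simp
  then have "directional d f (\<lambda>i. exp 0 * x i) x = 0"
    by (intro directional_curve_eq_0[OF f, of "\<lambda>z i. exp z * x i" x 0])
      (auto intro!: derivative_eq_intros)
  then show ?thesis
    by simp
qed

lemma directional_unit_vec: "i \<le> d \<Longrightarrow> directional d f x (unit_vec i) = peval (pdiff i f) x"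
  by (simp add: directional_def unit_vec_def if_distrib cong: if_cong)

lemma tangent_dim_eqI:
  assumes "\<And>f x i. f \<in> vanishing_ideal d X \<Longrightarrow> x \<in> P \<Longrightarrow> i \<le> d \<Longrightarrow> peval (pdiff i f) x = 0"
  shows "tangent_dim d X P = d"
proof -
  have "cone_tangent_space d X P = vecs d"
    using assms by (auto simp: cone_tangent_space_def)
  then show ?thesis
    by (simp add: tangent_dim_def vec_dim_vecs)
qed

lemma vertex_tangent_dim:
  assumes d: "d \<ge> 1"
  shows "tangent_dim d (gamma_moment_variety d) (hpoint (unit_vec d)) = d"
proof (rule tangent_dim_eqI)
  let ?M = "gamma_moment_variety d"
  fix f x i assume f: "f \<in> vanishing_ideal d ?M" and x: "x \<in> hpoint (unit_vec d)" and i: "i \<le> d"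
  obtain c where c: "c \<noteq> 0" "x = (\<lambda>j. c * unit_vec d j)"
    using x by (auto simp: hpoint_def)
  have hx: "hpoint x = hpoint (unit_vec d)"
    unfolding c by (rule hpoint_scale[OF c(1)])
  show "peval (pdiff i f) x = 0"
  proof (cases "i = d")
    case True
    have "directional d f x (vec_scale c (unit_vec d)) = 0"
      using directional_euler[OF f, of x] hx unit_vec_last_in_variety[OF d] c by (simp add: vec_scale_def)
    then show ?thesis
      using True c(1) by (simp add: directional_scale directional_unit_vec)
  next
    case False
    have "hpoint (\<lambda>j. x j + z * unit_vec i j) \<in> ?M" for z
    proof (cases "z = 0")
      case True
      then show ?thesis
        using hx unit_vec_last_in_variety[OF d] by simp
    next
      case z: False
      \<comment> \<open>The straight line through the vertex in direction \<open>i\<close> consists,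
        away from \<open>z = 0\<close>, of points of the line \<open>i\<close> with parameter
        \<open>c / z\<close>.\<close>
      have "(\<lambda>j. x j + z * unit_vec i j) = (\<lambda>j. z * line_vec d i (c / z) j)"
        using z c False by (auto simp: unit_vec_def line_vec_def fun_eq_iff)
      then show ?thesis
        using hpoint_scale[OF z] line_vec_in_variety[of i d "c / z"] i False by simp
    qed
    then have "directional d f (\<lambda>j. x j + 0 * unit_vec i j) (unit_vec i) = 0"
      by (intro directional_curve_eq_0[OF f]) (auto intro!: derivative_eq_intros)
    then show ?thesis
      using directional_unit_vec[OF i] by simp
  qed
qed

text \<open>For every \<theta> the curve \<open>u \<mapsto> gamma_vec d u \<theta>\<close> passes
  through this point at \<open>u = 0\<close>, and coordinate \<open>k + 1\<close> of its velocity is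
  \<open>k!\<close> times \<open>\<theta> ^ k\<close>. Annihilating all these velocities is a
  polynomial identity in \<theta>, whose coefficients are the partial derivatives up to nonzero
  factors.\<close>

lemma origin_tangent_dim:
  assumes d: "d \<ge> 1"
  shows "tangent_dim d (gamma_moment_variety d) (hpoint (unit_vec 0)) = d"
proof (rule tangent_dim_eqI)
  let ?M = "gamma_moment_variety d"
  fix f x i assume f: "f \<in> vanishing_ideal d ?M" and x: "x \<in> hpoint (unit_vec 0)" and i: "i \<le> d"
  obtain c where c: "c \<noteq> 0" "x = (\<lambda>j. c * unit_vec 0 j)"
    using x by (auto simp: hpoint_def)
  have hx: "hpoint x = hpoint (unit_vec 0)"
    unfolding c by (rule hpoint_scale[OF c(1)])
  have zero: "gamma_vec d 0 \<theta> = unit_vec 0" for \<theta>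
  proof
    fix j show "gamma_vec d 0 \<theta> j = unit_vec 0 j"
      by (cases j) (auto simp: gamma_vec_def unit_vec_def)
  qed
  have hM: "hpoint x \<in> ?M"
    using gamma_vec_in_variety[of d 0 0] hx zero by simp
  have sum: "(\<Sum>k\<le>d - 1. (peval (pdiff (Suc k) f) x * (c * fact k)) * \<theta> ^ k) = 0" for \<theta> :: complex
  proof -
    define v where "v j = (if j = 0 then 0 else c * (fact (j - 1) * \<theta> ^ (j - 1)))" for j
    have "directional d f (\<lambda>j. c * gamma_vec d 0 \<theta> j) v = 0"
    proof (rule directional_curve_eq_0[OF f, of "\<lambda>z j. c * gamma_vec d z \<theta> j" v 0])
      show "hpoint (\<lambda>j. c * gamma_vec d z \<theta> j) \<in> ?M" for z
        using hpoint_scale[OF c(1)] gamma_vec_in_variety by simp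
      fix j assume j: "j \<le> d"
      show "((\<lambda>z. c * gamma_vec d z \<theta> j) has_field_derivative v j) (at 0)"
      proof (cases j)
        case 0
        then show ?thesis
          by (simp add: v_def)
      next
        case (Suc k)
        \<comment> \<open>Coordinate \<open>Suc k\<close> with its factor \<open>l = 0\<close>, the
          variable itself, split off; the derivative at 0 is therefore the value of \<open>q\<close>
          there.\<close>
        define q where "q = (\<Prod>l<k. [:of_nat (Suc l) * \<theta>, 1:])"
        have "gamma_vec d z \<theta> j = z * poly q z" for z
          using j unfolding gamma_vec_def Suc q_def poly_prod prod.lessThan_Suc_shift
          by (simp add: add.commute)
        moreover have "poly q 0 = fact k * \<theta> ^ k"
          by (simp add: q_def poly_prod prod.distrib fact_prod_Suc atLeast0LessThan)
        moreover have "((\<lambda>z. c * (z * poly q z)) has_field_derivative c * poly q 0) (at 0)"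
          by (auto intro!: derivative_eq_intros poly_DERIV)
        ultimately show ?thesis
          by (simp add: v_def Suc)
      qed
    qed
    then have "(\<Sum>j\<le>d. peval (pdiff j f) x * v j) = 0"
      using c by (simp add: zero directional_def)
    moreover have "{..d} = {..Suc (d - 1)}"
      using d by simp
    ultimately have "(\<Sum>j\<le>Suc (d - 1). peval (pdiff j f) x * v j) = 0"
      by (simp only:)
    then show ?thesis
      unfolding sum.atMost_Suc_shift by (simp add: v_def mult.assoc)
  qed
  show "peval (pdiff i f) x = 0"
  proof (cases i)
    case 0
    have "directional d f x (vec_scale c (unit_vec 0)) = 0"
      using directional_euler[OF f hM] c by (simp add: vec_scale_def)
    then show ?thesis
      using 0 c(1) by (simp add: directional_scale directional_unit_vec)
  next
    case (Suc k)
    have "\<forall>k\<le>d - 1. peval (pdiff (Suc k) f) x * (c * fact k) = 0"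
      by (rule iffD1[OF polyfun_eq_0]) (use sum in blast)
    then show ?thesis
      using Suc i c(1) by auto
  qed
qed

section \<open>The two coordinate points and the singular locus\<close>

lemma proj_zeros_coordinates:
  assumes k: "k \<le> d"
  shows "proj_zeros d (ideal_gen d (pvar ` ({..d} - {k}))) = {hpoint (unit_vec k)}"
proof (intro equalityI subsetI)
  fix P assume P: "P \<in> proj_zeros d (ideal_gen d (pvar ` ({..d} - {k})))"
  then have Ps: "P \<in> proj_space d"
    by (simp add: proj_zeros_def)
  then obtain x where x: "x \<in> P"
    using hpoint_self by (auto simp: proj_space_def)
  note xP = proj_spaceE[OF Ps x]
  have "x j = 0" if j: "j \<le> d" "j \<noteq> k" for j
  proof -
    have "pvar j = (\<Sum>b\<in>{pvar j}. 1 * b)"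
      by simp
    moreover have "1 \<in> poly_ring d"
      using form_one by (auto simp: form_def)
    ultimately have "pvar j \<in> ideal_gen d (pvar ` ({..d} - {k}))"
      unfolding ideal_gen_def using j
      by (intro CollectI exI[of _ "{pvar j}"] exI[of _ "\<lambda>_. 1"]) auto
    then show ?thesis
      using P x by (auto simp: proj_zeros_def peval_pvar)
  qed
  then have "x = (\<lambda>j. x k * unit_vec k j)" "x k \<noteq> 0"
    using xP(2,3) by (auto simp: fun_eq_iff unit_vec_def vecs_def not_le[symmetric])
  then show "P \<in> {hpoint (unit_vec k)}"
    using xP(1) hpoint_scale[of "x k" "unit_vec k"] by simp
next
  fix P assume "P \<in> {hpoint (unit_vec k)}"
  then have P: "P = hpoint (unit_vec k)"
    by simp
  have "P \<in> proj_space d"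
    using k unfolding P proj_space_def
    by (intro CollectI exI[of _ "unit_vec k"]) (auto simp: vecs_def unit_vec_def)
  moreover have "peval f x = 0" if f: "f \<in> ideal_gen d (pvar ` ({..d} - {k}))" and x: "x \<in> P" for f x
  proof -
    obtain S c where S: "f = (\<Sum>b\<in>S. c b * b)" "S \<subseteq> pvar ` ({..d} - {k})"
      using f unfolding ideal_gen_def by blast
    have "peval b x = 0" if b: "b \<in> S" for b
    proof -
      obtain j where "b = pvar j" "j \<noteq> k"
        using S(2) b by auto
      then show ?thesis
        using x unfolding P by (auto simp: hpoint_def unit_vec_def peval_pvar)
    qed
    then show ?thesis
      using S(1) by (simp add: peval_simps)
  qed
  ultimately show "P \<in> proj_zeros d (ideal_gen d (pvar ` ({..d} - {k})))"
    by (simp add: proj_zeros_def)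
qed

theorem proposition4p6:
  fixes d :: nat
  assumes "d \<ge> 3"
  shows "\<exists>P Q. P \<noteq> Q \<and>
    proj_zeros d (ideal_gen d (pvar ` {0..d - 1})) = {P} \<and>
    proj_zeros d (ideal_gen d (pvar ` {1..d})) = {Q} \<and>
    singular_locus d (gamma_moment_variety d) = {P, Q}"
proof (intro exI conjI)
  let ?P = "hpoint (unit_vec d)" and ?Q = "hpoint (unit_vec 0)" and ?M = "gamma_moment_variety d"
  have "unit_vec d \<notin> ?Q"
    using assms by (auto simp: hpoint_def unit_vec_def fun_eq_iff intro!: exI[of _ d])
  then show "?P \<noteq> ?Q"
    using hpoint_self by blast
  have "{0..d - 1} = {..d} - {d}" "{1..d} = {..d} - {0}"
    using assms by auto
  then show "proj_zeros d (ideal_gen d (pvar ` {0..d - 1})) = {?P}"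
    "proj_zeros d (ideal_gen d (pvar ` {1..d})) = {?Q}"
    using proj_zeros_coordinates[of d d] proj_zeros_coordinates[of 0 d] by simp_all
  \<comment> \<open>The second singular point lies on the line with \<open>i = 0\<close>; it is the
    only point of the lines that \<open>line_vec_tangent_dim\<close> leaves out.\<close>
  have Q: "line_vec d 0 0 = unit_vec 0"
    by (auto simp: line_vec_def unit_vec_def)
  show "singular_locus d ?M = {?P, ?Q}"
  proof (intro equalityI subsetI)
    fix R assume R: "R \<in> singular_locus d ?M"
    then have M: "R \<in> ?M" and less: "local_dim d ?M R < enat (tangent_dim d ?M R)"
      by (auto simp: singular_locus_def)
    have smooth: False if "2 \<le> local_dim d ?M R" "tangent_dim d ?M R \<le> 2"
    proof -
      have "enat (tangent_dim d ?M R) \<le> 2"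
        using that(2) by (simp add: numeral_eq_enat)
      then show False
        using that(1) less by (meson leD order.trans)
    qed
    from assms M show "R \<in> {?P, ?Q}"
    proof (cases rule: gamma_variety_cases)
      case (surface u \<theta>)
      then show ?thesis
        using smooth gamma_vec_local_dim[of d u \<theta>] gamma_vec_tangent_dim[of d u \<theta>] assms by auto
    next
      case (line i y)
      show ?thesis
      proof (cases "i = 0 \<and> y = 0")
        case True
        then show ?thesis
          using line Q by simp
      next
        case False
        then show ?thesis
          using smooth line_vec_local_dim[of d i y] line_vec_tangent_dim[of d i y] assms line by blast
      qed
    qed simp
  next
    fix R assume "R \<in> {?P, ?Q}"
    then have R: "R \<in> ?M" "tangent_dim d ?M R = d"
      using assms unit_vec_last_in_variety[of d] vertex_tangent_dim[of d] origin_tangent_dim[of d]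
        line_vec_in_variety[of 0 d 0] by (auto simp: Q)
    \<comment> \<open>At both points the tangent space is the whole ambient space, so
      \<open>d \<ge> 3\<close> makes its dimension exceed that of a surface.\<close>
    have "(2 :: enat) < enat d"
      using assms by (simp add: numeral_eq_enat)
    then show "R \<in> singular_locus d ?M"
      using R local_dim_le_2[of d R] by (auto simp: singular_locus_def intro: le_less_trans)
  qed
qed

end
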